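(* Every Schnorr random real $x\in[0,1]$ is strongly UD-random: for every computable sequence $(u_n)_{n\in\mathbb{N}}$ of rationals for which there is $k>0$ with $|u_i-u_j|>k$ for all $i\ne j$, the sequence $(u_nx)_{n\in\mathbb{N}}$ is uniformly distributed modulo one.
   Context: For a real $y$, $\mathrm{frac}(y)=y-\lfloor y\rfloor$. A sequence $(y_n)$ of reals is uniformly distributed modulo one if for every interval $[u,v]\subseteq[0,1]$, the proportion of $j<N$ with $\mathrm{frac}(y_j)\in[u,v]$ tends to $v-u$ as $N\to\infty$. Schnorr randomness is with respect to Lebesgue measure on $[0,1]$; equivalently, $x$ is Schnorr random iff it belongs to only finitely many $A_n$ for every total Solovay test, i.e. every uniformly $\Sigma^0_1$ sequence of sets $(A_n)$ such that $\sum_n\lambda A_n$ is finite and a computable real. *)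

theory Defs
  imports "HOL-Analysis.Analysis"
begin

datatype recf = Zero | Succ | Proj nat | Comp recf "recf list" | Prim recf recf | Mn recf

inductive eval :: "recf \<Rightarrow> nat list \<Rightarrow> nat \<Rightarrow> bool" where
  eval_zero: "eval Zero xs 0"
| eval_succ: "eval Succ (x # xs) (Suc x)"
| eval_proj: "i < length xs \<Longrightarrow> eval (Proj i) xs (xs ! i)"
| eval_comp: "length ys = length gs \<Longrightarrow> (\<forall>i<length gs. eval (gs ! i) xs (ys ! i))
     \<Longrightarrow> eval f ys z \<Longrightarrow> eval (Comp f gs) xs z"
| eval_prim0: "eval f xs y \<Longrightarrow> eval (Prim f g) (0 # xs) y"
| eval_primS: "eval (Prim f g) (n # xs) y \<Longrightarrow> eval g (y # n # xs) z
     \<Longrightarrow> eval (Prim f g) (Suc n # xs) z"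
| eval_mn: "eval f (n # xs) 0 \<Longrightarrow> (\<forall>m<n. \<exists>y. eval f (m # xs) y \<and> 0 < y)
     \<Longrightarrow> eval (Mn f) xs n"

definition computable1 :: "(nat \<Rightarrow> nat) \<Rightarrow> bool" where
  "computable1 f \<longleftrightarrow> (\<exists>p. \<forall>n. eval p [n] (f n))"

definition computable2 :: "(nat \<Rightarrow> nat \<Rightarrow> nat) \<Rightarrow> bool" where
  "computable2 f \<longleftrightarrow> (\<exists>p. \<forall>n m. eval p [n, m] (f n m))"

definition computable_rat_seq :: "(nat \<Rightarrow> rat) \<Rightarrow> bool" where
  "computable_rat_seq u \<longleftrightarrow> (\<exists>a b c. computable1 a \<and> computable1 b \<and> computable1 c \<and>
     (\<forall>n. u n = (of_nat (a n) - of_nat (b n)) / of_nat (c n + 1)))"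

definition computable_rat_seq2 :: "(nat \<Rightarrow> nat \<Rightarrow> rat) \<Rightarrow> bool" where
  "computable_rat_seq2 u \<longleftrightarrow> (\<exists>a b c. computable2 a \<and> computable2 b \<and> computable2 c \<and>
     (\<forall>n m. u n m = (of_nat (a n m) - of_nat (b n m)) / of_nat (c n m + 1)))"

definition computable_real :: "real \<Rightarrow> bool" where
  "computable_real r \<longleftrightarrow> (\<exists>q. computable_rat_seq q \<and> (\<forall>k. \<bar>r - real_of_rat (q k)\<bar> \<le> 1 / 2 ^ k))"

definition unif_sigma01 :: "(nat \<Rightarrow> real set) \<Rightarrow> bool" where
  "unif_sigma01 A \<longleftrightarrow> (\<exists>a b. computable_rat_seq2 a \<and> computable_rat_seq2 b \<and>
     (\<forall>n. A n = {0..1} \<inter> (\<Union>m. {real_of_rat (a n m) <..< real_of_rat (b n m)})))"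

definition total_solovay_test :: "(nat \<Rightarrow> real set) \<Rightarrow> bool" where
  "total_solovay_test A \<longleftrightarrow> unif_sigma01 A \<and>
     summable (\<lambda>n. measure lborel (A n)) \<and> computable_real (\<Sum>n. measure lborel (A n))"

definition schnorr_random :: "real \<Rightarrow> bool" where
  "schnorr_random x \<longleftrightarrow> x \<in> {0..1} \<and>
     (\<forall>A. total_solovay_test A \<longrightarrow> finite {n. x \<in> A n})"

definition ud_mod1 :: "(nat \<Rightarrow> real) \<Rightarrow> bool" where
  "ud_mod1 y \<longleftrightarrow> (\<forall>u v. 0 \<le> u \<and> u \<le> v \<and> v \<le> 1 \<longrightarrow>
     (\<lambda>N. real (card {j. j < N \<and> frac (y j) \<in> {u..v}}) / real N) \<longlonglongrightarrow> v - u)"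

end

theory Submission
  imports Defs
begin

text \<open>By Weyl's criterion it suffices that the means of \<open>cos (2 * pi * h * u\<^sub>j * x + \<phi>)\<close>
  over \<open>j < N\<close> tend to 0. In square mean over \<open>x\<close> they are small because the frequencies are
  separated, so for \<open>N = n\<^sup>4\<close> the set of \<open>x\<close> with a mean above \<open>1 / E\<close> has measure
  \<open>O(1 / n\<^sup>2)\<close>. Approximating the cosine by a finite table and \<open>x\<close> by a fine grid, one covers this
  set by finitely many grid cells that a recursive function can list. These covers, padded to make
  their total measure rational, form a total Solovay test, which \<open>x\<close> passes. Since
  \<open>(n + 1)\<^sup>4 / n\<^sup>4\<close> tends to 1, smallness along fourth powers suffices.\<close>

section \<open>Recursive functions\<close>

text \<open>The phase \<open>\<phi>\<close> is an arbitrary real, so no program may compute with it.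
  For fixed \<open>h\<close>, \<open>\<phi>\<close> and \<open>E\<close> it enters only through a
  finite table, and the analytic constants only through one natural number \<open>d\<close>; a
  program for the test thus exists although none is obtained uniformly. A second obstacle is that
  the total measure of the test must be computable, not merely bounded. Hence grid points are
  selected by an exact comparison of natural numbers, with a threshold that leaves room for every
  rounding error on both sides, and the measure of a cover becomes a fraction obtained by counting
  cells. The exponent 4 comes from a crude estimate of the off-diagonal terms, which makes the mean
  square of order \<open>1 / sqrt N\<close>. With \<open>N = n ^ 4\<close> this is
  \<open>1 / n ^ 2\<close>, comparable with the terms of a telescoping series whose sum is known
  exactly.\<close>

definition recursive_on :: "nat \<Rightarrow> (nat list \<Rightarrow> nat) \<Rightarrow> bool" where
  "recursive_on n F \<longleftrightarrow> (\<exists>p. \<forall>xs. length xs = n \<longrightarrow> eval p xs (F xs))"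

lemma recursive_on_cong:
  assumes "recursive_on n F" "\<And>xs. length xs = n \<Longrightarrow> F xs = G xs"
  shows "recursive_on n G"
  using assms unfolding recursive_on_def by metis

lemma recursive_on_comp:
  assumes "recursive_on (length Fs) G" "\<And>F. F \<in> set Fs \<Longrightarrow> recursive_on n F"
  shows "recursive_on n (\<lambda>xs. G (map (\<lambda>F. F xs) Fs))"
proof -
  obtain g where g: "\<And>xs. length xs = length Fs \<Longrightarrow> eval g xs (G xs)"
    using assms(1) unfolding recursive_on_def by blast
  have "\<forall>i<length Fs. \<exists>p. \<forall>xs. length xs = n \<longrightarrow> eval p xs ((Fs ! i) xs)"
    using assms(2) unfolding recursive_on_def by simp
  then obtain ps where ps: "\<And>i xs. \<lbrakk>i < length Fs; length xs = n\<rbrakk> \<Longrightarrow> eval (ps i) xs ((Fs ! i) xs)"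
    by metis
  have "eval (Comp g (map ps [0..<length Fs])) xs (G (map (\<lambda>F. F xs) Fs))" if "length xs = n" for xs
    by (rule eval_comp[of "map (\<lambda>F. F xs) Fs"]) (use ps g that in auto)
  then show ?thesis unfolding recursive_on_def by blast
qed

lemma recursive_on_comp1:
  assumes "recursive_on 1 (\<lambda>xs. g (hd xs))" "recursive_on n F"
  shows "recursive_on n (\<lambda>xs. g (F xs))"
  using recursive_on_comp[of "[F]" "\<lambda>xs. g (hd xs)" n] assms by simp

lemma recursive_on_comp2:
  assumes "recursive_on 2 (\<lambda>xs. g (hd xs) (hd (tl xs)))" "recursive_on n F" "recursive_on n F'"
  shows "recursive_on n (\<lambda>xs. g (F xs) (F' xs))"
  using recursive_on_comp[of "[F, F']" "\<lambda>xs. g (hd xs) (hd (tl xs))" n] assms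
  by (auto simp: numeral_2_eq_2)

lemma recursive_on_nth: "i < n \<Longrightarrow> recursive_on n (\<lambda>xs. xs ! i)"
  unfolding recursive_on_def by (metis eval_proj)

lemma recursive_on_var0: "0 < n \<Longrightarrow> recursive_on n (\<lambda>xs. hd xs)"
  by (rule recursive_on_cong[OF recursive_on_nth[of 0 n]]) (auto simp: hd_conv_nth)

lemma recursive_on_var1: "1 < n \<Longrightarrow> recursive_on n (\<lambda>xs. hd (tl xs))"
  by (rule recursive_on_cong[OF recursive_on_nth[of 1 n]]) (auto simp: drop_Suc simp flip: hd_drop_conv_nth)

lemma recursive_on_var2: "2 < n \<Longrightarrow> recursive_on n (\<lambda>xs. hd (tl (tl xs)))"
  by (rule recursive_on_cong[OF recursive_on_nth[of 2 n]])
    (auto simp: drop_Suc numeral_2_eq_2 simp flip: hd_drop_conv_nth)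

lemma recursive_on_Suc: "recursive_on n F \<Longrightarrow> recursive_on n (\<lambda>xs. Suc (F xs))"
proof (rule recursive_on_comp1[of Suc])
  have "eval Succ xs (Suc (hd xs))" if "length xs = 1" for xs
    using that eval_succ by (cases xs) auto
  then show "recursive_on 1 (\<lambda>xs. Suc (hd xs))" unfolding recursive_on_def by blast
qed

lemma recursive_on_const: "recursive_on n (\<lambda>xs. c)"
proof (induction c)
  case 0
  show ?case unfolding recursive_on_def by (metis eval_zero)
qed (rule recursive_on_Suc)

text \<open>The order of the arguments of \<open>G\<close> mirrors \<open>eval_primS\<close>, which
  puts the accumulated value in front of the counter and the parameters behind both.\<close>

lemma recursive_on_prim:
  assumes "recursive_on n F" "recursive_on (Suc (Suc n)) (\<lambda>xs. G (hd xs) (hd (tl xs)) (tl (tl xs)))"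
  shows "recursive_on (Suc n) (\<lambda>xs. rec_nat (F (tl xs)) (\<lambda>i y. G y i (tl xs)) (hd xs))"
proof -
  obtain f where f: "\<And>xs. length xs = n \<Longrightarrow> eval f xs (F xs)"
    using assms(1) unfolding recursive_on_def by blast
  obtain g where g: "\<And>xs. length xs = Suc (Suc n) \<Longrightarrow> eval g xs (G (hd xs) (hd (tl xs)) (tl (tl xs)))"
    using assms(2) unfolding recursive_on_def by blast
  have *: "eval (Prim f g) (m # xs) (rec_nat (F xs) (\<lambda>i y. G y i xs) m)" if "length xs = n" for m xs
  proof (induction m)
    case 0
    show ?case using f[OF that] by (auto intro: eval_prim0)
  next
    case (Suc m)
    show ?case
      using eval_primS[OF Suc g[of "_ # m # xs"]] that by simp
  qed
  have "eval (Prim f g) xs (rec_nat (F (tl xs)) (\<lambda>i y. G y i (tl xs)) (hd xs))" if "length xs = Suc n" for xs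
    using *[of "tl xs" "hd xs"] that by (cases xs) auto
  then show ?thesis unfolding recursive_on_def by blast
qed

section \<open>Arithmetic, bounded sums, case distinctions and finite tables\<close>

lemma recursive_on_add:
  assumes "recursive_on n F" "recursive_on n G"
  shows "recursive_on n (\<lambda>xs. F xs + G xs)"
proof (rule recursive_on_comp2[OF _ assms])
  have "recursive_on (Suc 1) (\<lambda>xs. rec_nat (hd (tl xs)) (\<lambda>i y. Suc y) (hd xs))"
    using recursive_on_prim[of 1 hd "\<lambda>y i xs. Suc y"]
    by (simp add: recursive_on_Suc recursive_on_var0)
  moreover have "rec_nat k (\<lambda>i y. Suc y) m = m + k" for m k :: nat by (induction m) auto
  ultimately show "recursive_on 2 (\<lambda>xs. hd xs + hd (tl xs))" by (simp add: numeral_2_eq_2)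
qed

text \<open>The predecessor is a recursion that returns its counter, and truncated subtraction
  iterates it. The recursion variable, which comes first, is the subtrahend, so the two arguments
  are swapped at the end.\<close>

lemma recursive_on_diff:
  assumes "recursive_on n F" "recursive_on n G"
  shows "recursive_on n (\<lambda>xs. F xs - G xs)"
proof -
  have "recursive_on (Suc 0) (\<lambda>xs. rec_nat 0 (\<lambda>i y. i) (hd xs))"
    using recursive_on_prim[of 0 "\<lambda>_. 0" "\<lambda>y i xs. i"]
    by (simp add: recursive_on_var1 recursive_on_const)
  moreover have "rec_nat 0 (\<lambda>i y. i) m = m - 1" for m :: nat by (cases m) auto
  ultimately have *: "recursive_on 1 (\<lambda>xs. hd xs - 1)" by simp
  have "recursive_on 3 (\<lambda>xs. hd xs - 1)"
    using recursive_on_comp1[OF *, of 3 hd] by (simp add: recursive_on_var0)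
  then have "recursive_on (Suc 1) (\<lambda>xs. rec_nat (hd (tl xs)) (\<lambda>i y. y - 1) (hd xs))"
    using recursive_on_prim[of 1 hd "\<lambda>y i xs. y - 1"]
    by (simp add: recursive_on_var0 numeral_3_eq_3)
  moreover have "rec_nat k (\<lambda>i y. y - 1) m = k - m" for m k :: nat by (induction m) auto
  ultimately have "recursive_on 2 (\<lambda>xs. hd (tl xs) - hd xs)" by (simp add: numeral_2_eq_2)
  from recursive_on_comp2[OF this assms(2,1)] show ?thesis .
qed

text \<open>After this lemma primitive recursion is not invoked again: multiplication, division and
  the counting of cells are all written as bounded sums.\<close>

lemma recursive_on_sum:
  assumes B: "recursive_on n B" and F: "recursive_on (Suc n) (\<lambda>xs. F (hd xs) (tl xs))"
  shows "recursive_on n (\<lambda>xs. \<Sum>i<B xs. F i xs)"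
proof -
  \<comment> \<open>In the recursion step the accumulator stands at the head of the list; composing
    with projections shifted by one lets \<open>F\<close> skip it.\<close>
  have "recursive_on (Suc (Suc n)) (\<lambda>xs. F (hd (tl xs)) (tl (tl xs)))"
  proof (rule recursive_on_cong)
    show "recursive_on (Suc (Suc n)) (\<lambda>xs. (\<lambda>xs. F (hd xs) (tl xs)) (map (\<lambda>F. F xs) (map (\<lambda>i xs. xs ! Suc i) [0..<Suc n])))"
      by (rule recursive_on_comp) (use F recursive_on_nth in \<open>auto simp del: upt_Suc\<close>)
    fix xs :: "nat list" assume "length xs = Suc (Suc n)"
    then have "map (\<lambda>F. F xs) (map (\<lambda>i xs. xs ! Suc i) [0..<Suc n]) = tl xs"
      by (intro nth_equalityI) (auto simp: nth_tl simp del: upt_Suc)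
    then show "(\<lambda>xs. F (hd xs) (tl xs)) (map (\<lambda>F. F xs) (map (\<lambda>i xs. xs ! Suc i) [0..<Suc n])) = F (hd (tl xs)) (tl (tl xs))"
      by simp
  qed
  then have "recursive_on (Suc n) (\<lambda>xs. rec_nat 0 (\<lambda>i y. y + F i (tl xs)) (hd xs))"
    using recursive_on_prim[of n "\<lambda>_. 0" "\<lambda>y i xs. y + F i xs"]
    by (simp add: recursive_on_add recursive_on_var0 recursive_on_const)
  moreover have "rec_nat 0 (\<lambda>i y. y + F i xs) m = (\<Sum>i<m. F i xs)" for m xs by (induction m) auto
  ultimately have *: "recursive_on (Suc n) (\<lambda>xs. \<Sum>i<hd xs. F i (tl xs))" by simp
  have id: "map ((\<lambda>F. F xs) \<circ> (\<lambda>i xs. xs ! i)) [0..<n] = xs" if "length xs = n" for xs :: "nat list"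
    using that by (intro nth_equalityI) auto
  show ?thesis
    by (rule recursive_on_cong[OF recursive_on_comp[of "B # map (\<lambda>i xs. xs ! i) [0..<n]" _ n]])
      (use * B recursive_on_nth id in auto)
qed

lemma recursive_on_mult:
  assumes "recursive_on n F" "recursive_on n G"
  shows "recursive_on n (\<lambda>xs. F xs * G xs)"
proof (rule recursive_on_comp2[OF _ assms])
  show "recursive_on 2 (\<lambda>xs. hd xs * hd (tl xs))"
    using recursive_on_sum[of 2 hd "\<lambda>i xs. hd (tl xs)"]
    by (simp add: recursive_on_var0 recursive_on_var2)
qed

lemma recursive_on_if_less:
  assumes "recursive_on n P" "recursive_on n Q" "recursive_on n F" "recursive_on n G"
  shows "recursive_on n (\<lambda>xs. if P xs < Q xs then F xs else G xs)"
proof (rule recursive_on_cong)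
  \<comment> \<open>With truncated subtraction, \<open>1 - (Q xs - P xs)\<close> is the indicator of
    \<open>Q xs \<le> P xs\<close>.\<close>
  show "recursive_on n (\<lambda>xs. (1 - (1 - (Q xs - P xs))) * F xs + (1 - (Q xs - P xs)) * G xs)"
    by (intro recursive_on_add recursive_on_mult recursive_on_diff recursive_on_const assms)
qed auto

lemma recursive_on_if_eq:
  assumes "recursive_on n P" "recursive_on n Q" "recursive_on n F" "recursive_on n G"
  shows "recursive_on n (\<lambda>xs. if P xs = Q xs then F xs else G xs)"
proof (rule recursive_on_cong)
  show "recursive_on n (\<lambda>xs. if P xs < Q xs then G xs else if Q xs < P xs then G xs else F xs)"
    by (intro recursive_on_if_less assms)
qed auto

text \<open>The quotient counts the positive multiples of the divisor up to the dividend. The inner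
  test on the divisor reproduces the convention that division by 0 gives 0.\<close>

lemma recursive_on_div:
  assumes "recursive_on n F" "recursive_on n G"
  shows "recursive_on n (\<lambda>xs. F xs div G xs)"
proof (rule recursive_on_comp2[OF _ assms])
  have *: "(\<Sum>i<p. if p < Suc i * q then 0 else if 0 < q then 1 else 0) = p div q" for p q :: nat
  proof (cases "q = 0")
    case False
    have "(\<Sum>i<p. if p < Suc i * q then 0 else if 0 < q then 1 else 0) = (\<Sum>i<p. if Suc i \<le> p div q then 1 else (0::nat))"
      using False by (intro sum.cong) (auto simp: less_eq_div_iff_mult_less_eq)
    also have "\<dots> = card {i. i < p \<and> Suc i \<le> p div q}"
      by (simp add: sum.If_cases Int_def conj_commute)
    also have "{i. i < p \<and> Suc i \<le> p div q} = {..<p div q}"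
      using div_le_dividend[of p q] by (auto intro: less_le_trans)
    finally show ?thesis by simp
  qed simp
  have "recursive_on 2 (\<lambda>xs. \<Sum>i<hd xs. if hd xs < Suc i * hd (tl xs) then 0 else if 0 < hd (tl xs) then 1 else 0)"
    by (intro recursive_on_sum recursive_on_if_less recursive_on_mult recursive_on_Suc
        recursive_on_var0 recursive_on_var1 recursive_on_var2 recursive_on_const) auto
  then show "recursive_on 2 (\<lambda>xs. hd xs div hd (tl xs))" by (simp only: *)
qed

lemma recursive_on_mod:
  assumes "recursive_on n F" "recursive_on n G"
  shows "recursive_on n (\<lambda>xs. F xs mod G xs)"
  unfolding minus_div_mult_eq_mod[symmetric]
  by (intro recursive_on_diff recursive_on_mult recursive_on_div assms)

text \<open>Finitely many values can be hard-coded one by one, so \<open>G\<close> may be any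
  function at all. This is how values of the cosine at real phases get into a program.\<close>

lemma recursive_on_table:
  assumes "recursive_on n F"
  shows "recursive_on n (\<lambda>xs. if F xs < L then G (F xs) else 0)"
proof (induction L)
  case 0
  show ?case using recursive_on_const[of n 0] by simp
next
  case (Suc L)
  show ?case
    by (rule recursive_on_cong[OF recursive_on_if_eq[OF assms recursive_on_const[of n L] recursive_on_const[of n "G L"] Suc]])
      auto
qed

section \<open>Transfer between computable functions and recursive functions of lists\<close>

lemma recursive_on_computable1:
  assumes "computable1 f" "recursive_on n F"
  shows "recursive_on n (\<lambda>xs. f (F xs))"
proof (rule recursive_on_comp1[OF _ assms(2)])
  obtain p where "\<And>n. eval p [n] (f n)" using assms(1) unfolding computable1_def by blast
  then have "eval p xs (f (hd xs))" if "length xs = 1" for xs using that by (cases xs) auto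
  then show "recursive_on 1 (\<lambda>xs. f (hd xs))" unfolding recursive_on_def by blast
qed

lemma recursive_on_computable2:
  assumes "computable2 f" "recursive_on n F" "recursive_on n G"
  shows "recursive_on n (\<lambda>xs. f (F xs) (G xs))"
proof (rule recursive_on_comp2[OF _ assms(2,3)])
  obtain p where p: "\<And>n m. eval p [n, m] (f n m)" using assms(1) unfolding computable2_def by blast
  have "eval p xs (f (hd xs) (hd (tl xs)))" if "length xs = 2" for xs
    using that p[of "hd xs" "hd (tl xs)"] by (auto simp: numeral_2_eq_2 length_Suc_conv)
  then show "recursive_on 2 (\<lambda>xs. f (hd xs) (hd (tl xs)))" unfolding recursive_on_def by blast
qed

lemma computable1I:
  assumes "recursive_on 1 (\<lambda>xs. f (hd xs))"
  shows "computable1 f"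
proof -
  obtain p where p: "\<And>xs. length xs = 1 \<Longrightarrow> eval p xs (f (hd xs))"
    using assms unfolding recursive_on_def by blast
  show ?thesis unfolding computable1_def using p[of "[_]"] by auto
qed

lemma computable2I:
  assumes "recursive_on 2 (\<lambda>xs. f (hd xs) (hd (tl xs)))"
  shows "computable2 f"
proof -
  obtain p where p: "\<And>xs. length xs = 2 \<Longrightarrow> eval p xs (f (hd xs) (hd (tl xs)))"
    using assms unfolding recursive_on_def by blast
  show ?thesis unfolding computable2_def using p[of "[_, _]"] by auto
qed

lemmas recursive_intros = recursive_on_Suc recursive_on_add recursive_on_mult
  recursive_on_diff recursive_on_div recursive_on_mod recursive_on_sum recursive_on_if_less
  recursive_on_if_eq recursive_on_var0 recursive_on_var1 recursive_on_var2 recursive_on_const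

section \<open>Solovay tests\<close>

text \<open>Serves to insert a padding interval after every cover of a test while the endpoints stay
  computable.\<close>

lemma computable_rat_seq2_interleave:
  assumes "computable_rat_seq2 s" "computable_rat_seq2 t"
  shows "computable_rat_seq2 (\<lambda>n. if even n then s (n div 2) else t (n div 2))"
proof -
  obtain a b c a' b' c' where comp: "computable2 a" "computable2 b" "computable2 c"
      "computable2 a'" "computable2 b'" "computable2 c'"
    and s: "\<And>n m. s n m = (of_nat (a n m) - of_nat (b n m)) / of_nat (c n m + 1)"
    and t: "\<And>n m. t n m = (of_nat (a' n m) - of_nat (b' n m)) / of_nat (c' n m + 1)"
    using assms unfolding computable_rat_seq2_def by metis
  define mix :: "(nat \<Rightarrow> nat \<Rightarrow> nat) \<Rightarrow> (nat \<Rightarrow> nat \<Rightarrow> nat) \<Rightarrow> nat \<Rightarrow> nat \<Rightarrow> nat"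
    where "mix f g n m = (if n mod 2 = 0 then f (n div 2) m else g (n div 2) m)" for f g n m
  have mix: "computable2 (mix f g)" if "computable2 f" "computable2 g" for f g
    unfolding mix_def
    by (intro computable2I recursive_intros recursive_on_computable2[OF that(1)] recursive_on_computable2[OF that(2)]) auto
  show ?thesis
    unfolding computable_rat_seq2_def
    by (rule exI[of _ "mix a a'"], rule exI[of _ "mix b b'"], rule exI[of _ "mix c c'"])
      (auto simp: s t intro!: mix comp, auto simp: mix_def)
qed

text \<open>The set of index \<open>2n+1\<close> is an interval whose length complements the measure of
  \<open>A n\<close> to a term of a telescoping series, so the total measure of the test is 1.\<close>

lemma schnorr_random_finite_cover:
  fixes l r :: "nat \<Rightarrow> nat \<Rightarrow> rat" and p q :: "nat \<Rightarrow> nat" and d :: nat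
  defines "A \<equiv> \<lambda>n. {0..1} \<inter> (\<Union>i. {real_of_rat (l n i) <..< real_of_rat (r n i)})"
  assumes x: "schnorr_random x"
    and comp: "computable_rat_seq2 l" "computable_rat_seq2 r" "computable1 p" "computable1 q"
    and q: "\<And>n. 0 < q n" and meas: "\<And>n. measure lborel (A n) = p n / q n"
    and d: "0 < d" and le: "\<And>n. measure lborel (A n) \<le> d / ((n + d) * (n + d + 1))"
  shows "finite {n. x \<in> A n}"
proof -
  \<comment> \<open>The fraction \<open>d / e n\<close> is
    \<open>d / (n + d) - d / (n + d + 1)\<close>, so the series telescopes to
    \<open>d / d = 1\<close>.\<close>
  define e where "e n = (n + d) * (n + d + 1)" for n
  have e: "e n > 0" for n using d by (simp add: e_def)
  \<comment> \<open>The padding length. A computable rational sequence needs a denominator of the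
    form \<open>c + 1\<close>; since \<open>e n * q n\<close> is positive, the truncated
    \<open>- 1\<close> is undone exactly.\<close>
  define w :: "nat \<Rightarrow> rat" where "w n = (of_nat (d * q n) - of_nat (p n * e n)) / of_nat (e n * q n - 1 + 1)" for n
  have eq0: "e n * q n > 0" for n using e q by simp
  have "of_nat (e n * q n - 1 + 1) = (of_nat (e n * q n) :: rat)" for n
    using eq0[of n] by (intro arg_cong[of _ _ of_nat]) linarith
  then have w: "real_of_rat (w n) = d / e n - measure lborel (A n)" for n
    unfolding w_def meas using e[of n] q[of n] by (simp add: of_rat_divide of_rat_diff of_rat_mult divide_simps)
  have w_comp: "computable_rat_seq2 (\<lambda>n i. w n)"
    unfolding computable_rat_seq2_def w_def e_def
    by (rule exI[of _ "\<lambda>n _. d * q n"], rule exI[of _ "\<lambda>n _. p n * ((n + d) * (n + d + 1))"],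
        rule exI[of _ "\<lambda>n _. (n + d) * (n + d + 1) * q n - 1"], intro conjI computable2I recursive_intros
        recursive_on_computable1[OF comp(3)] recursive_on_computable1[OF comp(4)] allI refl) auto
  have z_comp: "computable_rat_seq2 (\<lambda>n i. 0)"
    unfolding computable_rat_seq2_def
    by (intro exI[of _ "\<lambda>n i. 0"] conjI computable2I recursive_intros) auto
  have ends:
    "computable_rat_seq2 (\<lambda>n. if even n then l (n div 2) else (\<lambda>i. 0))"
    "computable_rat_seq2 (\<lambda>n. if even n then r (n div 2) else (\<lambda>i. w (n div 2)))"
    using computable_rat_seq2_interleave[OF comp(1) z_comp] computable_rat_seq2_interleave[OF comp(2) w_comp]
    by auto
  define T where "T n = (if even n then A (n div 2) else {0..1} \<inter> {0<..<real_of_rat (w (n div 2))})" for n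
  have de: "d / e n \<le> 1" for n
  proof -
    have "d * 1 \<le> (n + d) * (n + d + 1)" by (rule mult_mono) auto
    then show ?thesis using e[of n] by (simp add: e_def divide_simps del: of_nat_mult of_nat_add)
  qed
  have w01: "0 \<le> real_of_rat (w n)" "real_of_rat (w n) \<le> 1" for n
  proof -
    have "measure lborel (A n) \<le> d / e n" using le[of n] by (simp add: e_def)
    then show "0 \<le> real_of_rat (w n)" "real_of_rat (w n) \<le> 1"
      using de[of n] measure_nonneg[of lborel "A n"] unfolding w by linarith+
  qed
  have T1: "measure lborel (T (Suc (n * 2))) = d / e n - measure lborel (A n)" for n
  proof -
    have "T (Suc (n * 2)) = {0<..<real_of_rat (w n)}" using w01(2)[of n] by (auto simp: T_def simp del: of_rat_le_1_iff)
    then show ?thesis using w01(1)[of n] by (simp add: w)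
  qed
  have T0: "T (n * 2) = A n" for n by (simp add: T_def)
  have pair: "(\<Sum>i\<in>{n*2..<n*2+2}. measure lborel (T i)) = d / e n" for n
  proof -
    have "{n*2..<n*2+2} = {n*2, Suc (n*2)}" by auto
    then show ?thesis using T1[of n] T0[of n] by simp
  qed
  have tel: "(\<lambda>n. d / e n) sums 1"
  proof -
    have "(\<lambda>n. real d / real (n + d)) \<longlonglongrightarrow> 0"
      by (rule real_tendsto_divide_at_top[OF tendsto_const])
        (rule filterlim_compose[OF filterlim_real_sequentially filterlim_add_const_nat_at_top])
    from telescope_sums'[OF this]
    have "(\<lambda>n. real d / real (n + d) - real d / real (Suc n + d)) sums (real d / real (0 + d) - 0)" .
    moreover have "real d / real (n + d) - real d / real (Suc n + d) = d / e n" for n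
    proof -
      define a where "a = real (n + d)"
      have "real (Suc n + d) = a + 1" "real (e n) = a * (a + 1)" "a > 0"
        using d by (simp_all add: a_def e_def algebra_simps)
      moreover from this have "d / a - d / (a + 1) = d / (a * (a + 1))" by (simp add: field_simps)
      ultimately show ?thesis by (simp only: a_def)
    qed
    ultimately show ?thesis using d by simp
  qed
  have "summable (\<lambda>n. measure lborel (T n))"
  proof (rule summableI_nonneg_bounded)
    fix n
    \<comment> \<open>Doubling the range makes it a union of whole pairs, each consisting of a cover
      and its padding with measures adding up to \<open>d / e m\<close>.\<close>
    have "(\<Sum>i<n. measure lborel (T i)) \<le> (\<Sum>i<n*2. measure lborel (T i))"
      by (rule sum_mono2) auto
    also have "\<dots> = (\<Sum>m<n. \<Sum>i\<in>{m*2..<m*2+2}. measure lborel (T i))"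
      by (rule sum.nat_group[symmetric])
    also have "\<dots> = (\<Sum>m<n. d / e m)" by (simp only: pair)
    also have "\<dots> \<le> 1"
      using sum_le_suminf[OF sums_summable[OF tel], of "{..<n}"] sums_unique[OF tel] by simp
    finally show "(\<Sum>i<n. measure lborel (T i)) \<le> 1" .
  qed simp
  moreover from this have "(\<Sum>n. measure lborel (T n)) = 1"
    using sums_group[OF summable_sums, of "\<lambda>n. measure lborel (T n)" 2] pair tel
    by (auto dest: sums_unique2)
  moreover have "computable_real 1"
    unfolding computable_real_def computable_rat_seq_def
    by (rule exI[of _ "\<lambda>_. 1"], rule conjI, rule exI[of _ "\<lambda>_. 1"], intro exI[of _ "\<lambda>_. 0"] conjI computable1I recursive_intros) auto
  moreover have "unif_sigma01 T"
    unfolding unif_sigma01_def by (intro exI conjI, rule ends(1), rule ends(2)) (auto simp: T_def A_def)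
  ultimately have "total_solovay_test T" unfolding total_solovay_test_def by simp
  then have "finite {n. x \<in> T n}" using x unfolding schnorr_random_def by blast
  then have "finite ((\<lambda>n. n * 2) -` {n. x \<in> T n})"
    by (rule finite_vimageI) (simp add: inj_on_def)
  then show ?thesis by (simp add: T0)
qed

section \<open>Measure estimates\<close>

text \<open>Neighbouring intervals overlap, so their lengths cannot be added. Up to grid points,
  however, the open cell between \<open>j / K\<close> and \<open>(j + 1) / K\<close> is covered
  exactly when one of its two ends is selected, and these cells are disjoint.\<close>

lemma measure_grid_cells:
  fixes K :: nat
  assumes K: "0 < K"
  shows "measure lborel ({0..1} \<inter> (\<Union>k\<in>Q. {(real k - 1) / K <..< (real k + 1) / K})) =
    card {j. j < K \<and> (j \<in> Q \<or> Suc j \<in> Q)} / K"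
proof -
  define J where "J = {j. j < K \<and> (j \<in> Q \<or> Suc j \<in> Q)}"
  define cell where "cell j = {real j / K <..< (real j + 1) / K}" for j
  have fin: "finite J" by (rule finite_subset[of _ "{..<K}"]) (auto simp: J_def)
  have cell: "y \<in> cell j \<longleftrightarrow> real j < K * y \<and> K * y < real j + 1" for y :: real and j
    using K by (simp add: cell_def field_simps)
  have disj: "disjoint_family_on cell J"
  proof (unfold disjoint_family_on_def, intro ballI impI)
    fix i j :: nat assume "i \<noteq> j"
    show "cell i \<inter> cell j = {}"
    proof (rule ccontr)
      assume "cell i \<inter> cell j \<noteq> {}"
      then obtain y where "y \<in> cell i" "y \<in> cell j" by blast
      then have "real i < real j + 1" "real j < real i + 1"
        unfolding cell by linarith+
      with \<open>i \<noteq> j\<close> show False by linarith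
    qed
  qed
  \<comment> \<open>Only the grid points of the unit interval lie in no open cell; they form a
    finite null set.\<close>
  have "AE y in lborel. y \<notin> (\<lambda>i. real i / K) ` {..K}"
    by (rule AE_not_in) (auto intro: finite_imp_null_set_lborel)
  then have "AE y in lborel. y \<in> {0..1} \<inter> (\<Union>k\<in>Q. {(real k - 1) / K <..< (real k + 1) / K}) \<longleftrightarrow> y \<in> (\<Union>j\<in>J. cell j)"
  proof (rule AE_mp, intro AE_I2 impI)
    fix y assume y: "y \<notin> (\<lambda>i. real i / K) ` {..K}"
    have near: "y \<in> {(real k - 1) / K <..< (real k + 1) / K} \<longleftrightarrow> \<bar>K * y - real k\<bar> < 1" for k
      using K by (auto simp: field_simps abs_if)
    show "y \<in> {0..1} \<inter> (\<Union>k\<in>Q. {(real k - 1) / K <..< (real k + 1) / K}) \<longleftrightarrow> y \<in> (\<Union>j\<in>J. cell j)"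
    proof
      assume "y \<in> {0..1} \<inter> (\<Union>k\<in>Q. {(real k - 1) / K <..< (real k + 1) / K})"
      then obtain k where k: "k \<in> Q" "\<bar>K * y - real k\<bar> < 1" and y01: "0 \<le> y" "y \<le> 1"
        unfolding near[symmetric] by auto
      define j where "j = nat \<lfloor>K * y\<rfloor>"
      have j: "real j \<le> K * y" "K * y < real j + 1" using y01 by (auto simp: j_def)
      have "K * y \<le> K" using y01 by (simp add: mult_left_le)
      have "real i \<noteq> K * y" if "i \<le> K" for i
      proof
        assume "real i = K * y"
        then have "y = real i / K" using K by (simp add: field_simps)
        then show False using y that by auto
      qed
      moreover have "j \<le> K" using j(1) \<open>K * y \<le> K\<close> by linarith
      ultimately have lt: "real j < K * y" using j(1) by (simp add: less_le)
      then have "j < K" using \<open>K * y \<le> K\<close> by linarith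
      moreover have "k = j \<or> k = Suc j" using k(2) lt j(2) by linarith
      ultimately have "j \<in> J" using k(1) by (auto simp: J_def)
      then show "y \<in> (\<Union>j\<in>J. cell j)" using lt j(2) cell by blast
    next
      assume "y \<in> (\<Union>j\<in>J. cell j)"
      then obtain j where j: "j \<in> J" "real j < K * y" "K * y < real j + 1" using cell by auto
      then have "j < K" and Q: "j \<in> Q \<or> Suc j \<in> Q" by (auto simp: J_def)
      have "0 < K * y" using j(2) by linarith
      then have "0 \<le> y" using K by (simp add: zero_less_mult_iff)
      moreover have "K * y \<le> K * 1" using j(3) \<open>j < K\<close> by linarith
      then have "y \<le> 1" using K by (simp add: mult_le_cancel_left)
      moreover have "\<bar>K * y - real j\<bar> < 1" "\<bar>K * y - real (Suc j)\<bar> < 1" using j by auto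
      ultimately show "y \<in> {0..1} \<inter> (\<Union>k\<in>Q. {(real k - 1) / K <..< (real k + 1) / K})"
        using Q unfolding Int_iff UN_iff near atLeastAtMost_iff by blast
    qed
  qed
  then have "measure lborel ({0..1} \<inter> (\<Union>k\<in>Q. {(real k - 1) / K <..< (real k + 1) / K})) = measure lborel (\<Union>j\<in>J. cell j)"
    by (rule measure_eq_AE) (auto simp: cell_def intro!: sets.Int borel_open)
  also have "\<dots> = (\<Sum>j\<in>J. measure lborel (cell j))"
    by (rule measure_finite_Union[OF fin _ disj]) (auto simp: cell_def emeasure_lborel_Ioo divide_right_mono)
  also have "\<dots> = (\<Sum>j\<in>J. 1 / K)"
    by (intro sum.cong refl) (simp add: cell_def divide_right_mono diff_divide_distrib[symmetric])
  finally show ?thesis by (simp add: J_def)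
qed

text \<open>Terms at distance at most \<open>k * M\<close> contribute at most \<open>1 / k\<close>
  each, and there are at most \<open>2 * M + 1\<close> of them: rounding
  \<open>(v j - v i) / k\<close> down is injective by separation and lands between
  \<open>- M\<close> and \<open>M\<close>. The at most \<open>N\<close> remaining terms are below
  \<open>1 / (k * M)\<close>. This avoids sorting the frequencies and summing a harmonic
  series.\<close>

lemma separated_sum_inverse_le:
  fixes v :: "nat \<Rightarrow> real"
  assumes k: "0 < k" and sep: "\<And>i j. i \<noteq> j \<Longrightarrow> k < \<bar>v i - v j\<bar>" and M: "0 < M"
  shows "(\<Sum>j\<in>{..<N} - {i}. 1 / \<bar>v i - v j\<bar>) \<le> (2 * real M + 1) / k + N / (k * M)"
proof -
  define S where "S = {j \<in> {..<N} - {i}. \<bar>v i - v j\<bar> \<le> k * M}"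
  define g where "g j = \<lfloor>(v j - v i) / k\<rfloor>" for j
  have "inj_on g S"
  proof (rule inj_onI, rule ccontr)
    fix a b assume "g a = g b" "a \<noteq> b"
    then have "\<bar>(v a - v i) / k - (v b - v i) / k\<bar> < 1" unfolding g_def by linarith
    then have "\<bar>v a - v b\<bar> < k" using k by (simp add: diff_divide_distrib[symmetric] abs_divide)
    then show False using sep[OF \<open>a \<noteq> b\<close>] by simp
  qed
  moreover have "g ` S \<subseteq> {- int M..int M}"
  proof
    fix y assume "y \<in> g ` S"
    then obtain j where "y = g j" "\<bar>v i - v j\<bar> \<le> k * M" unfolding S_def by auto
    moreover from this have "(v j - v i) / k \<le> M" "- real M \<le> (v j - v i) / k"
      using k by (auto simp: field_simps abs_if split: if_splits)
    ultimately show "y \<in> {- int M..int M}" unfolding g_def by (simp add: le_floor_iff) linarith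
  qed
  ultimately have "card S \<le> card {- int M..int M}"
    by (metis card_image card_mono finite_atLeastAtMost_int)
  then have cS: "real (card S) \<le> 2 * M + 1" by simp
  have "(\<Sum>j\<in>{..<N} - {i}. 1 / \<bar>v i - v j\<bar>) =
      (\<Sum>j\<in>S. 1 / \<bar>v i - v j\<bar>) + (\<Sum>j\<in>{..<N} - {i} - S. 1 / \<bar>v i - v j\<bar>)"
    by (subst sum.subset_diff[of S]) (auto simp: S_def)
  also have "\<dots> \<le> (\<Sum>j\<in>S. 1 / k) + (\<Sum>j\<in>{..<N} - {i} - S. 1 / (k * M))"
  proof (intro add_mono sum_mono divide_left_mono)
    fix j assume j: "j \<in> S"
    then have "i \<noteq> j" by (auto simp: S_def)
    then show "k \<le> \<bar>v i - v j\<bar>" "0 < \<bar>v i - v j\<bar> * k" using sep[of i j] k by auto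
  next
    fix j assume "j \<in> {..<N} - {i} - S"
    then have "k * M < \<bar>v i - v j\<bar>" "i \<noteq> j" by (auto simp: S_def)
    then show "k * M \<le> \<bar>v i - v j\<bar>" "0 < \<bar>v i - v j\<bar> * (k * M)" using sep[of i j] k M by auto
  qed auto
  also have "\<dots> \<le> (2 * real M + 1) * (1 / k) + N * (1 / (k * M))"
  proof -
    have "card ({..<N} - {i} - S) \<le> N"
      using card_mono[of "{..<N}" "{..<N} - {i} - S"] by auto
    then show ?thesis
      using cS k M by (simp del: times_divide_eq_right) (intro add_mono mult_right_mono; simp)
  qed
  finally show ?thesis by simp
qed

text \<open>Phrased with \<open>has_integral\<close> so that integrals evaluated by antiderivatives
  can be plugged in directly.\<close>

lemma Markov_inequality_Icc:
  fixes f :: "real \<Rightarrow> real"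
  assumes A: "A \<in> sets borel" "A \<subseteq> {0..1}" and f: "(f has_integral I) {0..1}"
    and nonneg: "\<And>x. x \<in> {0..1} \<Longrightarrow> 0 \<le> f x" and le: "\<And>x. x \<in> A \<Longrightarrow> c \<le> f x"
  shows "c * measure lborel A \<le> I"
proof -
  have "emeasure lborel A \<le> emeasure lborel {0..1::real}" using A by (intro emeasure_mono) auto
  also have "\<dots> < \<infinity>" by simp
  finally have "((\<lambda>x. c * 1) has_integral c * measure lborel A) A"
    using A by (intro has_integral_mult_right has_integral_measure_lborel) auto
  then have "((\<lambda>x. if x \<in> A then c else 0) has_integral c * measure lborel A) {0..1}"
    using has_integral_restrict[OF A(2), of "\<lambda>_. c"] by simp
  then show ?thesis by (rule has_integral_le[OF _ f]) (use nonneg le in auto)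
qed

text \<open>Adding the square of the sine sum leaves only difference frequencies, which the
  separation of the \<open>v i\<close> keeps away from 0.\<close>

lemma measure_large_cos_sum_le:
  fixes v :: "nat \<Rightarrow> real"
  assumes k: "0 < k" and sep: "\<And>i j. i \<noteq> j \<Longrightarrow> k < \<bar>v i - v j\<bar>"
    and w: "1 \<le> \<bar>w\<bar>" and n: "0 < n" and e: "0 < e"
    and A: "A \<in> sets borel" "A \<subseteq> {0..1}"
    and large: "\<And>x. x \<in> A \<Longrightarrow> e * n ^ 4 \<le> \<bar>\<Sum>j<n ^ 4. cos (w * v j * x + \<phi>)\<bar>"
  shows "measure lborel A \<le> (1 + 4 / k) / (e\<^sup>2 * n\<^sup>2)"
proof -
  define N where "N = n ^ 4"
  define f where "f x = (\<Sum>i<N. \<Sum>j<N. cos (w * (v i - v j) * x))" for x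
  define I where "I i j = (if i = j then 1 else sin (w * (v i - v j)) / (w * (v i - v j)))" for i j
  have f_eq: "f x = (\<Sum>j<N. cos (w * v j * x + \<phi>))\<^sup>2 + (\<Sum>j<N. sin (w * v j * x + \<phi>))\<^sup>2" for x
  proof -
    have "cos (w * (v i - v j) * x) = cos (w * v i * x + \<phi>) * cos (w * v j * x + \<phi>) + sin (w * v i * x + \<phi>) * sin (w * v j * x + \<phi>)" for i j
      unfolding cos_diff[symmetric] by (simp add: algebra_simps)
    then show ?thesis by (simp add: f_def power2_eq_square sum_product sum.distrib)
  qed
  have int1: "((\<lambda>x. cos (w * (v i - v j) * x)) has_integral I i j) {0..1}" for i j
  proof (cases "i = j")
    case True
    then show ?thesis using has_integral_const_real[of "1::real" 0 1] by (simp add: I_def)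
  next
    case False
    then have nz: "w * (v i - v j) \<noteq> 0" using sep[of i j] k w by auto
    define b where "b = w * (v i - v j)"
    have "((\<lambda>x. cos (b * x)) has_integral (sin (b * 1) / b - sin (b * 0) / b)) {0..1}"
      using nz unfolding b_def[symmetric]
      by (intro fundamental_theorem_of_calculus)
        (auto intro!: derivative_eq_intros simp flip: has_real_derivative_iff_has_vector_derivative)
    then show ?thesis using False by (simp add: I_def b_def)
  qed
  have int: "(f has_integral (\<Sum>i<N. \<Sum>j<N. I i j)) {0..1}"
    unfolding f_def by (intro has_integral_sum int1) auto
  have row: "(\<Sum>j<N. I i j) \<le> n\<^sup>2 * (1 + 4 / k)" if "i < N" for i
  proof -
    have n1: "1 \<le> real n" using n by simp
    have n2: "1 \<le> (real n)\<^sup>2" using power_mono[OF n1, of 2] by simp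
    have "(\<Sum>j<N. I i j) = 1 + (\<Sum>j\<in>{..<N} - {i}. I i j)"
      using that by (subst sum.remove[of _ i]) (auto simp: I_def)
    also have "(\<Sum>j\<in>{..<N} - {i}. I i j) \<le> (\<Sum>j\<in>{..<N} - {i}. 1 / \<bar>v i - v j\<bar>)"
    proof (rule sum_mono)
      fix j assume j: "j \<in> {..<N} - {i}"
      then have pos: "0 < \<bar>v i - v j\<bar>" using sep[of i j] k by auto
      have "I i j \<le> \<bar>sin (w * (v i - v j)) / (w * (v i - v j))\<bar>"
        using j abs_ge_self by (auto simp: I_def simp del: abs_divide)
      also have "\<dots> = \<bar>sin (w * (v i - v j))\<bar> / (\<bar>w\<bar> * \<bar>v i - v j\<bar>)" by (simp add: abs_mult)
      also have "\<dots> \<le> 1 / \<bar>v i - v j\<bar>"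
        using pos w by (intro frac_le) (auto simp: mult_le_cancel_right1)
      finally show "I i j \<le> 1 / \<bar>v i - v j\<bar>" .
    qed
    \<comment> \<open>The cut-off \<open>M = n\<^sup>2\<close> is the square root of
      \<open>N\<close>; it balances the near part, of order \<open>M / k\<close>, with the far part
      \<open>N / (k * M)\<close>.\<close>
    also have "(\<Sum>j\<in>{..<N} - {i}. 1 / \<bar>v i - v j\<bar>) \<le> (2 * real (n\<^sup>2) + 1) / k + real N / (k * real (n\<^sup>2))"
      by (rule separated_sum_inverse_le[OF k sep]) (use n in auto)
    also have "real N / (k * real (n\<^sup>2)) = (real n)\<^sup>2 / k"
      using n k by (simp add: N_def field_simps power2_eq_square power4_eq_xxxx)
    finally have "(\<Sum>j<N. I i j) \<le> 1 + ((2 * (real n)\<^sup>2 + 1) / k + (real n)\<^sup>2 / k)" by simp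
    \<comment> \<open>Since \<open>1 \<le> n\<^sup>2\<close>, the numerator
      \<open>3 * n\<^sup>2 + 1\<close> is at most \<open>4 * n\<^sup>2\<close>, which is the origin
      of the 4 in \<open>1 + 4 / k\<close>.\<close>
    also have "\<dots> \<le> (real n)\<^sup>2 + ((3 * (real n)\<^sup>2 + 1 * (real n)\<^sup>2) / k)"
      unfolding add_divide_distrib[symmetric]
      using n2 k by (intro add_mono divide_right_mono) auto
    finally show ?thesis by (simp add: field_simps)
  qed
  have "(e * N)\<^sup>2 * measure lborel A \<le> (\<Sum>i<N. \<Sum>j<N. I i j)"
  proof (rule Markov_inequality_Icc[OF A int])
    fix x assume "x \<in> A"
    from large[OF this] have "(e * N)\<^sup>2 \<le> \<bar>\<Sum>j<N. cos (w * v j * x + \<phi>)\<bar>\<^sup>2"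
      using e by (intro power_mono) (auto simp: N_def)
    then show "(e * N)\<^sup>2 \<le> f x" unfolding f_eq by (simp add: add_increasing2)
  qed (simp add: f_eq)
  also have "\<dots> \<le> (\<Sum>i<N. n\<^sup>2 * (1 + 4 / k))" by (intro sum_mono row) auto
  \<comment> \<open>Of the two factors \<open>N\<close> in \<open>(e * N)\<^sup>2\<close> one
    cancels the number of rows; the other, \<open>n ^ 4\<close>, against the row bound of order
    \<open>n\<^sup>2\<close> leaves \<open>1 / n\<^sup>2\<close>.\<close>
  also have "\<dots> = (e * N)\<^sup>2 * ((1 + 4 / k) / (e\<^sup>2 * n\<^sup>2))"
    using n e by (simp add: N_def power2_eq_square power4_eq_xxxx field_simps)
  finally have le: "(e * N)\<^sup>2 * measure lborel A \<le> (e * N)\<^sup>2 * ((1 + 4 / k) / (e\<^sup>2 * n\<^sup>2))" .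
  have "0 < (e * N)\<^sup>2" using e n by (simp add: N_def)
  from mult_left_le_imp_le[OF le this] show ?thesis by simp
qed

section \<open>Weyl's criterion\<close>

text \<open>The free phase lets one constructor cover cosines, sines and, with \<open>h = 0\<close>,
  constants.\<close>

inductive trig_poly :: "(real \<Rightarrow> real) \<Rightarrow> bool" where
  trig_poly_cos: "trig_poly (\<lambda>t. c * cos (2 * pi * of_int h * t + \<phi>))"
| trig_poly_add: "trig_poly f \<Longrightarrow> trig_poly g \<Longrightarrow> trig_poly (\<lambda>t. f t + g t)"

text \<open>On two generators this is the product-to-sum formula, under which the phases are
  subtracted and added just like the frequencies.\<close>

lemma trig_poly_mult: "trig_poly f \<Longrightarrow> trig_poly g \<Longrightarrow> trig_poly (\<lambda>t. f t * g t)"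
proof (induction rule: trig_poly.induct)
  case (trig_poly_cos c h \<phi>)
  from this show ?case
  proof (induction rule: trig_poly.induct)
    case (trig_poly_cos c' h' \<psi>)
    have "(\<lambda>t. c * cos (2 * pi * of_int h * t + \<phi>) * (c' * cos (2 * pi * of_int h' * t + \<psi>))) =
      (\<lambda>t. c * c' / 2 * cos (2 * pi * of_int (h - h') * t + (\<phi> - \<psi>)) +
           c * c' / 2 * cos (2 * pi * of_int (h + h') * t + (\<phi> + \<psi>)))"
    proof
      fix t
      define a where "a = 2 * pi * of_int h * t + \<phi>"
      define b where "b = 2 * pi * of_int h' * t + \<psi>"
      have ab: "2 * pi * of_int (h - h') * t + (\<phi> - \<psi>) = a - b"
        "2 * pi * of_int (h + h') * t + (\<phi> + \<psi>) = a + b"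
        by (simp_all add: a_def b_def algebra_simps)
      show "c * cos (2 * pi * of_int h * t + \<phi>) * (c' * cos (2 * pi * of_int h' * t + \<psi>)) =
        c * c' / 2 * cos (2 * pi * of_int (h - h') * t + (\<phi> - \<psi>)) +
        c * c' / 2 * cos (2 * pi * of_int (h + h') * t + (\<phi> + \<psi>))"
        unfolding ab a_def[symmetric] b_def[symmetric] by (simp add: cos_add cos_diff field_simps)
    qed
    then show ?case by (simp only:) (intro trig_poly.intros)
  next
    case (trig_poly_add f g)
    then show ?case
      using trig_poly.trig_poly_add[OF trig_poly_add.IH] by (simp add: distrib_left)
  qed
next
  case (trig_poly_add f f')
  then show ?case
    using trig_poly.trig_poly_add[OF trig_poly_add.IH] by (simp add: distrib_right)
qed

lemma trig_poly_const: "trig_poly (\<lambda>t. c)"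
  using trig_poly_cos[of c 0 0] by simp

lemma trig_poly_periodic: "trig_poly f \<Longrightarrow> f (t + of_int n) = f t"
proof (induction rule: trig_poly.induct)
  case (trig_poly_cos c h \<phi>)
  have "2 * pi * of_int h * (t + of_int n) + \<phi> = (2 * pi * of_int h * t + \<phi>) + 2 * pi * of_int (h * n)"
    by (simp add: algebra_simps)
  then show ?case by (simp only: cos_add cos_int_2pin sin_int_2pin) simp
qed simp

lemma trig_poly_frac: "trig_poly f \<Longrightarrow> f (frac t) = f t"
  using trig_poly_periodic[of f t "- \<lfloor>t\<rfloor>"] by (simp add: frac_def)

text \<open>The condition \<open>g 0 = g 1\<close> lets \<open>g\<close> descend to a continuous
  function \<open>G\<close> on the unit circle. Stone-Weierstrass applies there to the algebra of
  functions whose pullback to the line is a trigonometric polynomial.\<close>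

lemma trig_poly_approx:
  fixes g :: "real \<Rightarrow> real"
  assumes g: "continuous_on {0..1} g" "g 0 = g 1" and e: "0 < e"
  obtains f where "trig_poly f" "\<And>t. t \<in> {0..1} \<Longrightarrow> \<bar>g t - f t\<bar> < e"
proof -
  define p where "p t = cis (2 * pi * t)" for t :: real
  define S where "S = sphere (0::complex) 1"
  define G where "G z = g (Arg2pi z / (2 * pi))" for z
  define P where "P F \<longleftrightarrow> continuous_on S F \<and> (\<exists>f. trig_poly f \<and> (\<forall>t. F (p t) = f t))" for F :: "complex \<Rightarrow> real"
  have p_cont: "continuous_on {0..1} p" unfolding p_def by (intro continuous_intros)
  have S_eq: "p ` {0..1} = S"
  proof
    show "p ` {0..1} \<subseteq> S" by (auto simp: S_def p_def)
    show "S \<subseteq> p ` {0..1}"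
    proof
      fix z assume "z \<in> S"
      then have "z = cis (Arg2pi z)" using Arg2pi_eq[of z] by (simp add: S_def cis_conv_exp mult.commute)
      then have "z = p (Arg2pi z / (2 * pi))" by (simp add: p_def)
      moreover have "Arg2pi z / (2 * pi) \<in> {0..1}"
        using Arg2pi_ge_0[of z] Arg2pi_lt_2pi[of z] by simp
      ultimately show "z \<in> p ` {0..1}" by blast
    qed
  qed
  have Gp: "G (p t) = g t" if "t \<in> {0..1}" for t
  proof (cases "t = 1")
    case True
    moreover have "Arg2pi 1 = 0" by (rule Arg2pi_unique[of 1]) auto
    ultimately show ?thesis using g(2) by (simp add: G_def p_def)
  next
    case False
    then have "Arg2pi (p t) = 2 * pi * t"
      using that by (intro Arg2pi_unique[of 1]) (auto simp: p_def cis_conv_exp mult.commute)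
    then show ?thesis by (simp add: G_def)
  qed
  \<comment> \<open>\<open>Arg2pi\<close> jumps at 1, so continuity is not read off the formula for
    \<open>G\<close>. Instead \<open>p\<close> is a quotient map, being a continuous surjection from
    a compact interval onto the circle, and \<open>G\<close> after \<open>p\<close> is
    \<open>g\<close>.\<close>
  have G_cont: "continuous_on S G"
  proof (subst continuous_on_open_gen[of G S UNIV]; (intro allI impI)?)
    show "G \<in> S \<rightarrow> UNIV" by simp
  next
    fix U :: "real set" assume "openin (top_of_set UNIV) U"
    then have "openin (top_of_set {0..1}) ({0..1} \<inter> g -` U)"
      using g(1) by (simp add: continuous_openin_preimage_gen)
    also have "{0..1} \<inter> g -` U = {0..1} \<inter> p -` (S \<inter> G -` U)"
    proof (rule set_eqI)
      fix t show "t \<in> {0..1} \<inter> g -` U \<longleftrightarrow> t \<in> {0..1} \<inter> p -` (S \<inter> G -` U)"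
        using S_eq Gp[of t] by (cases "t \<in> {0..1}") auto
    qed
    finally show "openin (top_of_set S) (S \<inter> G -` U)"
      using Abstract_Topology_2.continuous_imp_quotient_map[OF p_cont S_eq compact_Icc, of "S \<inter> G -` U"] by simp
  qed
  have "\<exists>F. P F \<and> (\<forall>z\<in>S. \<bar>G z - F z\<bar> < e)"
  proof (rule Stone_Weierstrass_HOL[OF _ _ _ _ _ _ G_cont e])
    show "compact S" by (simp add: S_def)
    show "P (\<lambda>x. c)" for c unfolding P_def using trig_poly_const by auto
    show "continuous_on S F" if "P F" for F using that by (simp add: P_def)
    show "P (\<lambda>z. F z + H z)" if "P F \<and> P H" for F H
    proof -
      obtain f f' where "trig_poly f" "\<forall>t. F (p t) = f t" "trig_poly f'" "\<forall>t. H (p t) = f' t"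
        using \<open>P F \<and> P H\<close> unfolding P_def by blast
      then have "trig_poly (\<lambda>t. f t + f' t)" "\<forall>t. F (p t) + H (p t) = f t + f' t"
        by (auto intro: trig_poly_add)
      moreover have "continuous_on S (\<lambda>z. F z + H z)"
        using \<open>P F \<and> P H\<close> unfolding P_def by (auto intro: continuous_on_add)
      ultimately show ?thesis unfolding P_def by blast
    qed
    show "P (\<lambda>z. F z * H z)" if "P F \<and> P H" for F H
    proof -
      obtain f f' where "trig_poly f" "\<forall>t. F (p t) = f t" "trig_poly f'" "\<forall>t. H (p t) = f' t"
        using \<open>P F \<and> P H\<close> unfolding P_def by blast
      then have "trig_poly (\<lambda>t. f t * f' t)" "\<forall>t. F (p t) * H (p t) = f t * f' t"
        by (auto intro: trig_poly_mult)
      moreover have "continuous_on S (\<lambda>z. F z * H z)"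
        using \<open>P F \<and> P H\<close> unfolding P_def by (auto intro: continuous_on_mult)
      ultimately show ?thesis unfolding P_def by blast
    qed
    show "\<exists>F. P F \<and> F x \<noteq> F y" if "x \<in> S \<and> y \<in> S \<and> x \<noteq> y" for x y
    proof -
      have "P Re"
        unfolding P_def p_def using trig_poly_cos[of 1 1 0] by (auto intro!: continuous_intros)
      \<comment> \<open>The phase \<open>- (pi / 2)\<close> turns the cosine into a sine;
        \<open>Re\<close> and \<open>Im\<close> together separate the points of the circle.\<close>
      moreover have "P Im"
        unfolding P_def p_def using trig_poly_cos[of 1 1 "- (pi / 2)"]
        by (auto intro!: continuous_intros simp: cos_diff)
      ultimately show ?thesis using that complex_eqI by metis
    qed
  qed
  then obtain F f where F: "\<forall>z\<in>S. \<bar>G z - F z\<bar> < e" and f: "trig_poly f" "\<forall>t. F (p t) = f t"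
    unfolding P_def by blast
  have "\<bar>g t - f t\<bar> < e" if "t \<in> {0..1}" for t
    using F Gp[OF that] f(2) that S_eq by (metis imageI)
  then show thesis using that f(1) by blast
qed

text \<open>Limit and integral are both additive and agree on generators: for frequency 0 both give
  the constant, for any other frequency both vanish.\<close>

lemma trig_poly_mean:
  assumes y: "\<And>h \<phi>. h \<noteq> 0 \<Longrightarrow> (\<lambda>N. (\<Sum>j<N. cos (2 * pi * of_int h * y j + \<phi>)) / real N) \<longlonglongrightarrow> 0"
    and "trig_poly f"
  shows "\<exists>I. (f has_integral I) {0..1} \<and> (\<lambda>N. (\<Sum>j<N. f (y j)) / real N) \<longlonglongrightarrow> I"
  using \<open>trig_poly f\<close>
proof (induction rule: trig_poly.induct)
  case (trig_poly_cos c h \<phi>)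
  show ?case
  proof (cases "h = 0")
    case True
    have "\<forall>\<^sub>F N in sequentially. c * cos \<phi> = (\<Sum>j<N. c * cos \<phi>) / real N"
      using eventually_gt_at_top[of 0] by eventually_elim simp
    then have "(\<lambda>N. (\<Sum>j<N. c * cos \<phi>) / real N) \<longlonglongrightarrow> c * cos \<phi>"
      by (rule Lim_transform_eventually[OF tendsto_const])
    moreover have "((\<lambda>t. c * cos \<phi>) has_integral c * cos \<phi>) {0..1::real}"
      using has_integral_const_real[of "c * cos \<phi>" 0 1] by simp
    ultimately show ?thesis using True by auto
  next
    case False
    define b where "b = 2 * pi * of_int h"
    have "b \<noteq> 0" using False by (simp add: b_def)
    have "((\<lambda>t. c * cos (b * t + \<phi>)) has_integral (c * sin (b * 1 + \<phi>) / b - c * sin (b * 0 + \<phi>) / b)) {0..1}"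
      using \<open>b \<noteq> 0\<close>
      by (intro fundamental_theorem_of_calculus)
        (auto intro!: derivative_eq_intros simp flip: has_real_derivative_iff_has_vector_derivative)
    moreover have "sin (b * 1 + \<phi>) = sin \<phi>" unfolding b_def by (simp add: sin_add)
    ultimately have "((\<lambda>t. c * cos (b * t + \<phi>)) has_integral 0) {0..1}" by simp
    moreover have "(\<lambda>N. (\<Sum>j<N. c * cos (b * y j + \<phi>)) / real N) \<longlonglongrightarrow> 0"
      using tendsto_mult_right_zero[OF y[OF False, of \<phi>], of c] by (simp add: b_def sum_distrib_left)
    ultimately show ?thesis unfolding b_def by blast
  qed
next
  case (trig_poly_add f g)
  then obtain I J where "(f has_integral I) {0..1}" "(\<lambda>N. (\<Sum>j<N. f (y j)) / real N) \<longlonglongrightarrow> I"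
    "(g has_integral J) {0..1}" "(\<lambda>N. (\<Sum>j<N. g (y j)) / real N) \<longlonglongrightarrow> J" by blast
  then show ?case
    by (intro exI[of _ "I + J"] conjI has_integral_add)
      (auto simp: sum.distrib add_divide_distrib intro: tendsto_add)
qed

text \<open>A trapezoid below the indicator of the open interval vanishes at 0 and 1, hence is
  periodic and can be approximated by trigonometric polynomials. One-sided bounds are enough,
  because upper bounds follow from those for complementary intervals.\<close>

lemma frequency_in_open_interval_ge:
  assumes y: "\<And>h \<phi>. h \<noteq> 0 \<Longrightarrow> (\<lambda>N. (\<Sum>j<N. cos (2 * pi * of_int h * y j + \<phi>)) / real N) \<longlonglongrightarrow> 0"
    and uv: "0 \<le> u" "u \<le> v" "v \<le> 1" and d: "0 < d"
  shows "\<forall>\<^sub>F N in sequentially. v - u - d < real (card {j. j < N \<and> frac (y j) \<in> {u<..<v}}) / real N"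
proof -
  \<comment> \<open>Five losses of \<open>\<delta>\<close>: two for the ramps of the trapezoid, two
    for approximating it by \<open>f\<close> (once in the integral, once in the mean), one for the
    limit.\<close>
  define \<delta> where "\<delta> = d / 5"
  have \<delta>: "\<delta> > 0" using d by (simp add: \<delta>_def)
  have zero: "max 0 (min 1 (min a b)) = 0" if "a \<le> 0 \<or> b \<le> 0" for a b :: real using that by auto
  define g where "g t = max 0 (min 1 (min ((t - u) / \<delta>) ((v - t) / \<delta>)))" for t
  have "continuous_on {0..1} g" unfolding g_def using \<delta> by (intro continuous_intros) auto
  moreover have "g 0 = g 1"
  proof -
    have "(0 - u) / \<delta> \<le> 0" "(v - 1) / \<delta> \<le> 0" using uv \<delta> by (auto simp: divide_nonpos_pos)
    then show ?thesis unfolding g_def by (metis zero)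
  qed
  ultimately obtain f where f: "trig_poly f" and fg: "\<And>t. t \<in> {0..1} \<Longrightarrow> \<bar>g t - f t\<bar> < \<delta>"
    using trig_poly_approx \<delta> by blast
  obtain I where I: "(f has_integral I) {0..1}" and lim: "(\<lambda>N. (\<Sum>j<N. f (y j)) / real N) \<longlonglongrightarrow> I"
    using trig_poly_mean[OF y f] by blast
  have I_ge: "v - u - 3 * \<delta> \<le> I"
  proof (cases "u + \<delta> \<le> v - \<delta>")
    case True
    have sub: "{u + \<delta>..v - \<delta>} \<subseteq> {0..1}" using uv \<delta> by auto
    have "((\<lambda>t. if t \<in> {u + \<delta>..v - \<delta>} then 1 else 0) has_integral (v - \<delta> - (u + \<delta>)) * 1) {0..1::real}"
      unfolding has_integral_restrict[OF sub] using has_integral_const_real[of "1::real" "u + \<delta>" "v - \<delta>"] True by simp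
    from has_integral_diff[OF this has_integral_const_real[of \<delta> 0 1]]
    have "((\<lambda>t. (if t \<in> {u + \<delta>..v - \<delta>} then 1 else 0) - \<delta>) has_integral (v - u - 3 * \<delta>)) {0..1}"
      by (simp add: algebra_simps)
    then show ?thesis
    proof (rule has_integral_le[OF _ I])
      fix t :: real assume t: "t \<in> {0..1}"
      have "(if t \<in> {u + \<delta>..v - \<delta>} then 1 else 0) \<le> g t" using \<delta> by (auto simp: g_def)
      then show "(if t \<in> {u + \<delta>..v - \<delta>} then 1 else 0) - \<delta> \<le> f t" using fg[OF t] by linarith
    qed
  next
    case False
    \<comment> \<open>The ramps meet here: \<open>v - u < 2 * \<delta>\<close>, so the bound to be
      shown lies below \<open>- \<delta>\<close>, and \<open>0 \<le> g\<close> already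
      suffices.\<close>
    have "((\<lambda>t. - \<delta>) has_integral - \<delta>) {0..1::real}" using has_integral_const_real[of "- \<delta>" 0 1] by simp
    then have "- \<delta> \<le> I"
    proof (rule has_integral_le[OF _ I])
      fix t :: real assume t: "t \<in> {0..1}"
      have "0 \<le> g t" by (simp add: g_def)
      then show "- \<delta> \<le> f t" using fg[OF t] by linarith
    qed
    then show ?thesis using False by linarith
  qed
  have ind: "f (y j) \<le> (if frac (y j) \<in> {u<..<v} then 1 else 0) + \<delta>" for j
  proof -
    have fr: "frac (y j) \<in> {0..1}" using frac_lt_1[of "y j"] by (simp add: less_imp_le)
    have "g t \<le> (if t \<in> {u<..<v} then 1 else 0)" for t
    proof (cases "t \<in> {u<..<v}")
      case False
      then have "(t - u) / \<delta> \<le> 0 \<or> (v - t) / \<delta> \<le> 0" using \<delta> by (auto simp: divide_le_0_iff)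
      from zero[OF this] show ?thesis by (simp add: g_def)
    qed (simp add: g_def)
    then show ?thesis using fg[OF fr] trig_poly_frac[OF f, of "y j"] by (smt (verit))
  qed
  have "\<forall>\<^sub>F N in sequentially. I - \<delta> < (\<Sum>j<N. f (y j)) / real N"
    using lim \<delta> by (intro order_tendstoD) auto
  then show ?thesis using eventually_gt_at_top[of 0]
  proof eventually_elim
    fix N :: nat assume N: "I - \<delta> < (\<Sum>j<N. f (y j)) / real N" "0 < N"
    have "(\<Sum>j<N. f (y j)) \<le> (\<Sum>j<N. (if frac (y j) \<in> {u<..<v} then 1 else 0) + \<delta>)"
      by (intro sum_mono ind)
    also have "\<dots> = real (card {j. j < N \<and> frac (y j) \<in> {u<..<v}}) + N * \<delta>"
      by (simp add: sum.distrib sum.If_cases Int_def del: greaterThanLessThan_iff)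
    finally have "(\<Sum>j<N. f (y j)) / real N \<le> (real (card {j. j < N \<and> frac (y j) \<in> {u<..<v}}) + N * \<delta>) / real N"
      by (simp add: divide_right_mono)
    also have "\<dots> = real (card {j. j < N \<and> frac (y j) \<in> {u<..<v}}) / real N + \<delta>"
      using N(2) by (simp add: add_divide_distrib)
    finally show "v - u - d < real (card {j. j < N \<and> frac (y j) \<in> {u<..<v}}) / real N"
      using N(1) I_ge unfolding \<delta>_def by linarith
  qed
qed

text \<open>The frequency of the closed interval is at least that of its interior and at most 1
  minus those of \<open>{0<..<u}\<close> and \<open>{v<..<1}\<close>. Two lower bounds enter the
  upper estimate, hence the tolerance \<open>e / 2\<close>.\<close>

theorem Weyl_criterion:
  assumes y: "\<And>h \<phi>. h \<noteq> 0 \<Longrightarrow> (\<lambda>N. (\<Sum>j<N. cos (2 * pi * of_int h * y j + \<phi>)) / real N) \<longlonglongrightarrow> 0"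
  shows "ud_mod1 y"
  unfolding ud_mod1_def
proof (intro allI impI)
  fix u v :: real assume "0 \<le> u \<and> u \<le> v \<and> v \<le> 1"
  then have uv: "0 \<le> u" "u \<le> v" "v \<le> 1" by auto
  define c where "c A N = real (card {j. j < N \<and> frac (y j) \<in> A}) / real N" for A N
  have le1: "c A N + c B N + c C N \<le> 1" if "A \<inter> B = {}" "A \<inter> C = {}" "B \<inter> C = {}" for A B C N
  proof -
    have "card {j. j < N \<and> frac (y j) \<in> A} + card {j. j < N \<and> frac (y j) \<in> B} + card {j. j < N \<and> frac (y j) \<in> C}
        = card ({j. j < N \<and> frac (y j) \<in> A} \<union> {j. j < N \<and> frac (y j) \<in> B} \<union> {j. j < N \<and> frac (y j) \<in> C})"
      using that by (subst card_Un_disjoint; (subst card_Un_disjoint)?; auto)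
    also have "\<dots> \<le> card {..<N}" by (rule card_mono) auto
    finally have "real (card {j. j < N \<and> frac (y j) \<in> A}) + real (card {j. j < N \<and> frac (y j) \<in> B}) + real (card {j. j < N \<and> frac (y j) \<in> C}) \<le> N"
      by simp
    then show ?thesis by (cases "N = 0") (simp_all add: c_def add_divide_distrib[symmetric])
  qed
  have "(c {u..v}) \<longlonglongrightarrow> v - u"
  proof (rule tendstoI)
    fix e :: real assume "0 < e"
    then have "0 < e / 2" by simp
    note ge = frequency_in_open_interval_ge[OF y _ _ _ this, folded c_def]
    have "\<forall>\<^sub>F N in sequentially. v - u - e / 2 < c {u<..<v} N"
      "\<forall>\<^sub>F N in sequentially. u - 0 - e / 2 < c {0<..<u} N"
      "\<forall>\<^sub>F N in sequentially. 1 - v - e / 2 < c {v<..<1} N"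
      by (intro ge; use uv in auto)+
    then show "\<forall>\<^sub>F N in sequentially. dist (c {u..v} N) (v - u) < e"
    proof eventually_elim
      fix N assume N: "v - u - e / 2 < c {u<..<v} N" "u - 0 - e / 2 < c {0<..<u} N" "1 - v - e / 2 < c {v<..<1} N"
      have "c {u<..<v} N \<le> c {u..v} N"
        unfolding c_def by (intro divide_right_mono of_nat_mono card_mono) auto
      moreover have "c {u..v} N + c {0<..<u} N + c {v<..<1} N \<le> 1" using uv by (intro le1) auto
      ultimately show "dist (c {u..v} N) (v - u) < e" using N by (simp add: dist_real_def)
    qed
  qed
  then show "(\<lambda>N. real (card {j. j < N \<and> frac (y j) \<in> {u..v}}) / real N) \<longlonglongrightarrow> v - u"
    unfolding c_def .
qed

section \<open>Means of cosines at a Schnorr random point\<close>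

lemma mean_tendsto_0_from_fourth_powers:
  fixes s :: "nat \<Rightarrow> real"
  assumes bound: "\<And>j. \<bar>s j\<bar> \<le> 1" and lim: "(\<lambda>n. (\<Sum>j<n ^ 4. s j) / real n ^ 4) \<longlonglongrightarrow> 0"
  shows "(\<lambda>N. (\<Sum>j<N. s j) / real N) \<longlonglongrightarrow> 0"
proof -
  define m where "m N = nat \<lfloor>root 4 (real N)\<rfloor>" for N :: nat
  \<comment> \<open>The mean at \<open>n ^ 4\<close> plus the relative length of the gap up to the
    next fourth power, which bounds the effect of the terms beyond \<open>n ^ 4\<close>.\<close>
  define b where "b n = \<bar>(\<Sum>j<n ^ 4. s j) / real n ^ 4\<bar> + ((1 + 1 / real n) ^ 4 - 1)" for n
  have m: "m N ^ 4 \<le> N" "N < Suc (m N) ^ 4" for N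
  proof -
    have r: "0 \<le> root 4 (real N)" "root 4 (real N) ^ 4 = N" by (simp_all add: real_root_pow_pos2)
    then have fl: "real (m N) \<le> root 4 (real N)" "root 4 (real N) < real (Suc (m N))"
      unfolding m_def by (simp_all add: of_nat_floor) linarith
    have "real (m N) ^ 4 \<le> root 4 (real N) ^ 4" using fl by (intro power_mono) auto
    moreover have "root 4 (real N) ^ 4 < real (Suc (m N)) ^ 4" using fl r by (intro power_strict_mono) auto
    ultimately have "real (m N ^ 4) \<le> real N" "real N < real (Suc (m N) ^ 4)" by (simp_all add: r)
    then show "m N ^ 4 \<le> N" "N < Suc (m N) ^ 4" by (simp_all only: of_nat_le_iff of_nat_less_iff)
  qed
  have "\<bar>(\<Sum>j<N. s j) / real N\<bar> \<le> b (m N)" if "0 < N" for N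
  proof -
    have "m N \<noteq> 0" using m(2)[of N] that by (intro notI) simp
    then have m0: "0 < real (m N) ^ 4" by simp
    have "(\<Sum>j<N. s j) = (\<Sum>j<m N ^ 4. s j) + (\<Sum>j\<in>{m N ^ 4..<N}. s j)"
      using m(1)[of N] by (simp add: sum.atLeastLessThan_concat atLeast0LessThan[symmetric])
    moreover have "\<bar>\<Sum>j\<in>{m N ^ 4..<N}. s j\<bar> \<le> (\<Sum>j\<in>{m N ^ 4..<N}. 1)"
      by (intro order_trans[OF sum_abs] sum_mono bound)
    moreover have "\<dots> = real N - real (m N ^ 4)" using m(1)[of N] by (simp add: of_nat_diff)
    moreover have "real N \<le> real (Suc (m N) ^ 4)" using m(2)[of N] by (metis less_imp_le of_nat_mono)
    ultimately have *: "\<bar>\<Sum>j<N. s j\<bar> \<le> \<bar>\<Sum>j<m N ^ 4. s j\<bar> + (real (Suc (m N)) ^ 4 - real (m N) ^ 4)"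
      by simp
    have "\<bar>(\<Sum>j<N. s j) / real N\<bar> = \<bar>\<Sum>j<N. s j\<bar> / real N" by simp
    also have "\<dots> \<le> \<bar>\<Sum>j<N. s j\<bar> / real (m N ^ 4)"
      using m(1)[of N] m0 that by (intro divide_left_mono of_nat_mono) auto
    also have "\<dots> \<le> (\<bar>\<Sum>j<m N ^ 4. s j\<bar> + (real (Suc (m N)) ^ 4 - real (m N) ^ 4)) / real (m N) ^ 4"
      using * m0 by (simp add: divide_right_mono)
    also have "\<dots> = b (m N)"
    proof -
      have "real (Suc (m N)) ^ 4 / real (m N) ^ 4 = (1 + 1 / real (m N)) ^ 4"
        using m0 by (simp add: power_divide[symmetric] add_divide_distrib add.commute)
      then show ?thesis using m0 by (simp add: b_def add_divide_distrib diff_divide_distrib)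
    qed
    finally show ?thesis .
  qed
  then have ev: "\<forall>\<^sub>F N in sequentially. norm ((\<Sum>j<N. s j) / real N) \<le> b (m N)"
    by (intro eventually_mono[OF eventually_gt_at_top[of 0]]) simp
  have b_lim: "b \<longlonglongrightarrow> 0"
  proof -
    have "b \<longlonglongrightarrow> \<bar>0\<bar> + ((1 + 0) ^ 4 - 1)"
      unfolding b_def by (intro tendsto_intros lim lim_1_over_n)
    then show ?thesis by simp
  qed
  have m_lim: "filterlim m sequentially sequentially"
    unfolding filterlim_at_top
  proof
    fix Z
    show "\<forall>\<^sub>F N in sequentially. Z \<le> m N"
      using eventually_ge_at_top[of "Z ^ 4"]
    proof eventually_elim
      fix N assume "Z ^ 4 \<le> N"
      then have "Z ^ 4 < Suc (m N) ^ 4" using m(2)[of N] by linarith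
      then have "Z < Suc (m N)" by (rule power_less_imp_less_base) simp
      then show "Z \<le> m N" by simp
    qed
  qed
  show ?thesis by (rule Lim_null_comparison[OF ev filterlim_compose[OF b_lim m_lim]])
qed

lemma abs_cos_diff_le: "\<bar>cos a - cos b\<bar> \<le> \<bar>a - b\<bar>" for a b :: real
proof -
  have "\<bar>cos a - cos b\<bar> = 2 * (\<bar>sin ((a + b) / 2)\<bar> * \<bar>sin ((b - a) / 2)\<bar>)"
    by (simp add: cos_diff_cos abs_mult)
  also have "\<dots> \<le> 2 * (1 * \<bar>(b - a) / 2\<bar>)"
    by (intro mult_left_mono mult_mono abs_sin_x_le_abs_x) auto
  finally show ?thesis by simp
qed

lemma cos_add_int: "cos (2 * pi * of_int h * (t + of_int n) + \<phi>) = cos (2 * pi * of_int h * t + \<phi>)"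
  using trig_poly_periodic[OF trig_poly_cos[of 1 h \<phi>], of t n] by simp

text \<open>Only a fixed accuracy \<open>1 / E\<close> is ever needed, so a finite table of natural numbers
  replaces the computation of cosines; it stores \<open>2 * E * (cos + 1)\<close> rounded down.\<close>

lemma cos_table_exists:
  fixes E :: nat and h :: int
  assumes E: "0 < E"
  obtains L :: nat and G :: "nat \<Rightarrow> nat" where "0 < L"
    "\<And>p q. 0 < q \<Longrightarrow>
      \<bar>real (G (L * p div q mod L)) / (2 * E) - 1 - cos (2 * pi * of_int h * (real p / real q) + \<phi>)\<bar> \<le> 1 / E"
proof -
  define W where "W = 2 * pi * \<bar>of_int h\<bar>"
  define f where "f t = cos (2 * pi * of_int h * t + \<phi>)" for t
  \<comment> \<open>\<open>W\<close> is a Lipschitz constant of \<open>f\<close>, so rounding the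
    argument to a multiple of \<open>1 / L\<close> costs at most \<open>1 / (2 * E)\<close>;
    rounding the value costs the other half of \<open>1 / E\<close>. \<open>Suc\<close> keeps
    \<open>L\<close> positive when \<open>h = 0\<close>.\<close>
  define L where "L = Suc (nat \<lceil>W * (2 * E)\<rceil>)"
  define G where "G i = nat \<lfloor>2 * E * (f (real i / L) + 1)\<rfloor>" for i :: nat
  have L0: "0 < real L" by (simp add: L_def)
  have L: "W / L \<le> 1 / (2 * E)"
  proof -
    have "W * (2 * E) \<le> real (nat \<lceil>W * (2 * E)\<rceil>)" by (rule real_nat_ceiling_ge)
    also have "\<dots> \<le> L" by (simp add: L_def)
    finally show ?thesis using E by (simp add: field_simps L_def)
  qed
  have lip: "\<bar>f s - f t\<bar> \<le> W * \<bar>s - t\<bar>" for s t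
    using abs_cos_diff_le[of "2 * pi * of_int h * s + \<phi>" "2 * pi * of_int h * t + \<phi>"]
    by (simp add: f_def W_def abs_mult right_diff_distrib[symmetric])
  have G: "\<bar>real (G i) / (2 * E) - 1 - f (real i / L)\<bar> \<le> 1 / (2 * E)" for i
  proof -
    have "0 \<le> f (real i / L) + 1" using cos_ge_minus_one[of "2 * pi * of_int h * (real i / L) + \<phi>"] unfolding f_def by linarith
    then have "\<bar>real (G i) - 2 * E * (f (real i / L) + 1)\<bar> \<le> 1"
      using E unfolding G_def by (simp add: of_nat_nat floor_correct) linarith
    moreover have "real (G i) / (2 * E) - 1 - f (real i / L) = (real (G i) - 2 * E * (f (real i / L) + 1)) / (2 * E)"
      using E by (simp add: field_simps)
    ultimately show ?thesis using E by (simp add: abs_divide divide_right_mono)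
  qed
  have "\<bar>real (G (L * p div q mod L)) / (2 * E) - 1 - f (real p / real q)\<bar> \<le> 1 / E" if q: "0 < q" for p q
  proof -
    define g where "g = L * p div q"
    \<comment> \<open>Reducing \<open>g\<close> modulo \<open>L\<close> subtracts the integer
      \<open>g div L\<close> from the argument \<open>g / L\<close>, which leaves a cosine of
      integer frequency unchanged.\<close>
    have "real g = real (L * (g div L)) + real (g mod L)"
      unfolding of_nat_add[symmetric] by (simp only: mult_div_mod_eq)
    then have "real g / L = real (g mod L) / L + of_int (int (g div L))"
      using L0 by (simp add: field_simps)
    then have per: "f (real g / L) = f (real (g mod L) / L)" unfolding f_def using cos_add_int by metis
    have "g = \<lfloor>real (L * p) / real q\<rfloor>" unfolding g_def by (simp only: floor_divide_of_nat_eq)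
    then have "\<bar>real (L * p) / real q - g\<bar> \<le> 1" by linarith
    moreover have "real p / real q - real g / L = (real (L * p) / real q - g) / L"
      using L0 by (simp add: field_simps)
    ultimately have "\<bar>real p / real q - real g / L\<bar> \<le> 1 / L" by (simp add: abs_divide divide_right_mono)
    then have "W * \<bar>real g / L - real p / real q\<bar> \<le> W * (1 / L)"
      unfolding abs_minus_commute[of "real g / L"] by (intro mult_left_mono) (auto simp: W_def)
    then have "\<bar>f (real g / L) - f (real p / real q)\<bar> \<le> 1 / (2 * E)"
      using lip[of "real g / L" "real p / real q"] L by simp
    moreover have "1 / (2 * real E) + 1 / (2 * real E) = 1 / E" using E by (simp add: field_simps)
    ultimately show ?thesis using G[of "g mod L"] unfolding per g_def[symmetric] by linarith
  qed
  then show thesis using that[of L G] unfolding f_def by (simp add: L_def)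
qed

text \<open>Comparing the real sum \<open>C n\<close> with a bound is not decidable, but comparing
  its integer approximation \<open>S n i\<close> is. A selected grid point guarantees that
  \<open>C n\<close> is large on the whole interval around it, an unselected one that it is moderate
  there; the gap between the two levels absorbs all errors. Largeness bounds the measure of the
  cover, and escaping the cover bounds the sum at \<open>x\<close>.\<close>

lemma eventually_cos_sum_le:
  fixes u :: "nat \<Rightarrow> rat" and E :: nat
  assumes x: "schnorr_random x" and u: "computable_rat_seq u"
    and k: "0 < k" and sep: "\<And>i j. i \<noteq> j \<Longrightarrow> k < \<bar>real_of_rat (u i) - real_of_rat (u j)\<bar>"
    and h: "h \<noteq> 0" and E: "0 < E"
  shows "\<forall>\<^sub>F n in sequentially.
    \<bar>\<Sum>j<n ^ 4. cos (2 * pi * of_int h * (real_of_rat (u j) * x) + \<phi>)\<bar> \<le> 5 / E * real n ^ 4"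
proof -
  obtain a b c where comp: "computable1 a" "computable1 b" "computable1 c"
    and u_eq: "\<And>n. u n = (of_nat (a n) - of_nat (b n)) / of_nat (c n + 1)"
    using u unfolding computable_rat_seq_def by blast
  define v where "v j = real_of_rat (u j)" for j
  have v_eq: "v j = (real (a j) - real (b j)) / real (c j + 1)" for j
    unfolding v_def u_eq by (simp add: of_rat_divide of_rat_diff of_rat_add)
  define W where "W = 2 * pi * of_int h"
  have W: "1 \<le> \<bar>W\<bar>"
  proof -
    have "1 * 1 \<le> 2 * pi * \<bar>real_of_int h\<bar>" using pi_gt3 h by (intro mult_mono) auto
    then show ?thesis by (simp add: W_def abs_mult)
  qed
  define f where "f t = cos (W * t + \<phi>)" for t
  obtain L G where L: "0 < L" and G: "\<And>p q. 0 < q \<Longrightarrow>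
      \<bar>real (G (L * p div q mod L)) / (2 * E) - 1 - f (real p / real q)\<bar> \<le> 1 / E"
    using cos_table_exists[OF E, of h \<phi>] unfolding f_def W_def by metis
  define tab where "tab i = (if i < L then G i else 0)" for i
  define H where "H = nat \<lceil>\<bar>W\<bar> * E\<rceil>"
  have H: "\<bar>W\<bar> * E \<le> H" unfolding H_def by (rule real_nat_ceiling_ge)
  define B where "B = (1 + 4 / k) / (1 / E)\<^sup>2"
  have B: "0 < B" using k E by (simp add: B_def add_pos_pos)
  \<comment> \<open>Chosen so that, for \<open>M = n + d\<close>, \<open>M + 1 \<le> 2 * M\<close>
    turns the bound \<open>B / M\<^sup>2\<close> into the telescoping
    \<open>d / (M * (M + 1))\<close>. As a single natural number it can be hard-coded.\<close>
  define d where "d = nat \<lceil>2 * B\<rceil>"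
  have d: "2 * B \<le> d" "0 < d"
    unfolding d_def using B by (rule_tac real_nat_ceiling_ge) (simp add: B)
  define N where "N n = (n + d) * (n + d) * (n + d) * (n + d)" for n
  have N4: "N n = (n + d) ^ 4" for n by (simp add: N_def power4_eq_xxxx)
  \<comment> \<open>\<open>K n\<close> is so large that \<open>C n\<close> varies by at most \<open>N n / E\<close> on a cell of length \<open>1 / K n\<close>.\<close>
  define K' where "K' n = H * (\<Sum>j<N n. a j + b j)" for n
  define K where "K n = K' n + 1" for n
  have K0: "0 < K n" for n by (simp add: K_def)
  \<comment> \<open>The coefficient \<open>q - 1\<close> of \<open>b j\<close> (instead of \<open>- 1\<close>) shifts the argument of the
    cosine by an integer and keeps it a natural fraction.\<close>
  define S where "S n i = (\<Sum>j<N n. tab (L * ((a j + b j * ((c j + 1) * K n - 1)) * i) div ((c j + 1) * K n) mod L))" for n i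
  \<comment> \<open>The sum of the two truncated differences is the absolute difference. The
    threshold is \<open>6 * N n\<close> because \<open>S n i\<close> has error at most
    \<open>2 * N n\<close>: the scaled sum exceeds \<open>4 * N n\<close> at selected grid points
    and is at most \<open>8 * N n\<close> at the others.\<close>
  define sel :: "nat \<Rightarrow> nat \<Rightarrow> nat" where
    "sel n i = (if 6 * N n < (S n i - 2 * E * N n) + (2 * E * N n - S n i) then 1 else 0)" for n i
  define C where "C n y = (\<Sum>j<N n. f (v j * y))" for n and y :: real

  have comp_tab: "computable1 tab"
    unfolding tab_def by (intro computable1I recursive_on_table recursive_on_var0) simp
  have comp_N: "computable1 N"
    unfolding N_def by (intro computable1I recursive_intros) auto
  have comp_K': "computable1 K'"
    unfolding K'_def
    by (intro computable1I recursive_intros recursive_on_computable1[OF comp_N]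
        recursive_on_computable1[OF comp(1)] recursive_on_computable1[OF comp(2)]) auto
  have comp_K: "computable1 K"
    unfolding K_def by (intro computable1I recursive_intros recursive_on_computable1[OF comp_K']) auto
  have comp_S: "computable2 S"
    unfolding S_def
    by (intro computable2I recursive_on_sum recursive_on_computable1[OF comp_tab]
        recursive_on_computable1[OF comp_N] recursive_on_computable1[OF comp_K]
        recursive_on_computable1[OF comp(1)] recursive_on_computable1[OF comp(2)]
        recursive_on_computable1[OF comp(3)] recursive_intros) auto
  have comp_sel: "computable2 sel"
    unfolding sel_def
    by (intro computable2I recursive_intros recursive_on_computable1[OF comp_N]
        recursive_on_computable2[OF comp_S]) auto

  have S_approx: "\<bar>real (S n i) - 2 * E * N n - 2 * E * C n (real i / K n)\<bar> \<le> 2 * N n" for n i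
  proof -
    have summand: "\<bar>real (tab (L * ((a j + b j * ((c j + 1) * K n - 1)) * i) div ((c j + 1) * K n) mod L)) - 2 * E - 2 * E * f (v j * (real i / K n))\<bar> \<le> 2"
      for j
    proof -
      define q where "q = (c j + 1) * K n"
      have q: "0 < q" using K0 by (simp add: q_def)
      define p where "p = (a j + b j * (q - 1)) * i"
      have "real (a j + b j * (q - 1)) = real (a j) - real (b j) + real (b j) * real q"
        using q by (simp add: of_nat_diff right_diff_distrib)
      then have "real p / real q = (real (a j) - real (b j)) * i / q + real (b j) * i"
        using q by (simp add: p_def field_simps)
      moreover have "(real (a j) - real (b j)) * i / q = v j * (real i / K n)"
        unfolding v_eq q_def by (simp only: of_nat_mult times_divide_times_eq)
      ultimately have "real p / real q = v j * (real i / K n) + of_int (int (b j * i))" by simp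
      then have "f (real p / real q) = f (v j * (real i / K n))"
        unfolding f_def W_def by (simp only: cos_add_int)
      moreover have "tab (L * p div q mod L) = G (L * p div q mod L)" using L by (simp add: tab_def)
      ultimately have "\<bar>real (tab (L * p div q mod L)) / (2 * E) - 1 - f (v j * (real i / K n))\<bar> \<le> 1 / E"
        using G[OF q, of p] by simp
      then have "2 * E * \<bar>real (tab (L * p div q mod L)) / (2 * E) - 1 - f (v j * (real i / K n))\<bar> \<le> 2 * E * (1 / E)"
        by (intro mult_left_mono) auto
      moreover have "real (tab (L * p div q mod L)) - 2 * E - 2 * E * f (v j * (real i / K n)) =
          2 * E * (real (tab (L * p div q mod L)) / (2 * E) - 1 - f (v j * (real i / K n)))"
        using E by (simp add: right_diff_distrib)
      ultimately have "\<bar>real (tab (L * p div q mod L)) - 2 * E - 2 * E * f (v j * (real i / K n))\<bar> \<le> 2"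
        using E by (simp add: abs_mult)
      then show ?thesis unfolding p_def q_def .
    qed
    have "real (S n i) - 2 * E * N n - 2 * E * C n (real i / K n) =
        (\<Sum>j<N n. real (tab (L * ((a j + b j * ((c j + 1) * K n - 1)) * i) div ((c j + 1) * K n) mod L)) - 2 * E - 2 * E * f (v j * (real i / K n)))"
      by (simp add: S_def C_def sum_subtractf sum_distrib_left)
    also have "\<bar>\<dots>\<bar> \<le> (\<Sum>j<N n. 2)" by (intro order_trans[OF sum_abs] sum_mono summand)
    finally show ?thesis by simp
  qed
  have sel_iff: "sel n i = 1 \<longleftrightarrow> 6 * N n < \<bar>real (S n i) - 2 * E * N n\<bar>" for n i
  proof -
    have "real ((S n i - 2 * E * N n) + (2 * E * N n - S n i)) = \<bar>real (S n i) - real (2 * E * N n)\<bar>"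
      by (cases "S n i \<le> 2 * E * N n") (simp_all add: of_nat_diff del: of_nat_mult)
    moreover have "sel n i = 1 \<longleftrightarrow> real (6 * N n) < real ((S n i - 2 * E * N n) + (2 * E * N n - S n i))"
      unfolding of_nat_less_iff by (simp add: sel_def)
    ultimately show ?thesis by simp
  qed
  have lip: "\<bar>C n y - C n (real i / K n)\<bar> \<le> N n / E" if "\<bar>y - real i / K n\<bar> \<le> 1 / K n" for n i y
  proof -
    have "\<bar>f (v j * y) - f (v j * (real i / K n))\<bar> \<le> 1 / E" if j: "j < N n" for j
    proof -
      have "\<bar>v j\<bar> \<le> (real (a j) + real (b j)) / 1"
        unfolding v_eq abs_divide by (rule frac_le) auto
      moreover have "a j + b j \<le> (\<Sum>j<N n. a j + b j)"
        using j by (intro member_le_sum) auto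
      then have "real (a j + b j) \<le> real (\<Sum>j<N n. a j + b j)" by (rule of_nat_mono)
      ultimately have "\<bar>v j\<bar> \<le> real (\<Sum>j<N n. a j + b j)" by simp
      then have "\<bar>W\<bar> * E * \<bar>v j\<bar> \<le> H * real (\<Sum>j<N n. a j + b j)" using H by (intro mult_mono) auto
      also have "\<dots> \<le> K n" by (simp add: K_def K'_def)
      finally have WvK: "\<bar>W\<bar> * \<bar>v j\<bar> * E \<le> K n" by (simp add: mult_ac)
      have "\<bar>f (v j * y) - f (v j * (real i / K n))\<bar> \<le> \<bar>(W * (v j * y) + \<phi>) - (W * (v j * (real i / K n)) + \<phi>)\<bar>"
        unfolding f_def by (rule abs_cos_diff_le)
      also have "\<dots> = \<bar>W * v j * (y - real i / K n)\<bar>" by (simp add: algebra_simps)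
      also have "\<dots> \<le> \<bar>W\<bar> * \<bar>v j\<bar> * (1 / K n)"
        unfolding abs_mult using that \<open>\<bar>y - real i / K n\<bar> \<le> 1 / K n\<close> by (intro mult_left_mono) auto
      also have "\<dots> \<le> 1 / E" using WvK K0[of n] E by (simp add: field_simps)
      finally show ?thesis .
    qed
    then have "(\<Sum>j<N n. \<bar>f (v j * y) - f (v j * (real i / K n))\<bar>) \<le> (\<Sum>j<N n. 1 / E)"
      by (intro sum_mono) auto
    moreover have "\<bar>C n y - C n (real i / K n)\<bar> \<le> (\<Sum>j<N n. \<bar>f (v j * y) - f (v j * (real i / K n))\<bar>)"
      using sum_abs[of "\<lambda>j. f (v j * y) - f (v j * (real i / K n))" "{..<N n}"]
      by (simp add: C_def sum_subtractf)
    ultimately show ?thesis by simp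
  qed
  \<comment> \<open>Dividing by \<open>2 * E\<close> turns the levels 4 and 8 into
    \<open>2 * (N n / E)\<close> and \<open>4 * (N n / E)\<close>. Moving from the grid point to
    \<open>y\<close> costs one more \<open>N n / E\<close>, which gives the factors 1 here and 5 in
    \<open>sel0\<close>.\<close>
  have sel1: "N n / E < \<bar>C n y\<bar>" if "\<bar>y - real i / K n\<bar> \<le> 1 / K n" "sel n i = 1" for n i y
  proof -
    have "4 * N n < \<bar>2 * E * C n (real i / K n)\<bar>" using S_approx[of n i] that(2) unfolding sel_iff by linarith
    then have "2 * (N n / E) < \<bar>C n (real i / K n)\<bar>" using E by (simp add: abs_mult field_simps)
    then show ?thesis using lip[OF that(1)] by linarith
  qed
  have sel0: "\<bar>C n y\<bar> \<le> 5 * (N n / E)" if "\<bar>y - real i / K n\<bar> \<le> 1 / K n" "sel n i \<noteq> 1" for n i y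
  proof -
    have "\<bar>2 * E * C n (real i / K n)\<bar> \<le> 8 * N n" using S_approx[of n i] that(2) unfolding sel_iff by linarith
    then have "\<bar>C n (real i / K n)\<bar> \<le> 4 * (N n / E)" using E by (simp add: abs_mult field_simps)
    then show ?thesis using lip[OF that(1)] by linarith
  qed

  \<comment> \<open>The factor \<open>sel n i\<close> collapses unselected intervals to the empty
    interval from 0 to 0. The denominator \<open>K' n + 1\<close> is \<open>K n\<close> in the shape
    required of computable rational sequences.\<close>
  define l r :: "nat \<Rightarrow> nat \<Rightarrow> rat"
    where "l n i = (of_nat (i * sel n i) - of_nat (sel n i)) / of_nat (K' n + 1)"
      and "r n i = (of_nat (Suc i * sel n i) - of_nat 0) / of_nat (K' n + 1)" for n i
  \<comment> \<open>Counts the cells with a selected end, the numerator supplied by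
    \<open>measure_grid_cells\<close>.\<close>
  define p where "p n = (\<Sum>j<K n. if 0 < sel n j + sel n (Suc j) then 1 else (0::nat))" for n
  define A where "A n = {0..1} \<inter> (\<Union>i. {real_of_rat (l n i) <..< real_of_rat (r n i)})" for n
  have comp_l: "computable_rat_seq2 l"
    unfolding computable_rat_seq2_def l_def
    by (rule exI[of _ "\<lambda>n i. i * sel n i"], rule exI[of _ sel], rule exI[of _ "\<lambda>n i. K' n"])
      (intro conjI comp_sel computable2I recursive_intros recursive_on_computable1[OF comp_K']
        recursive_on_computable2[OF comp_sel] allI refl; simp)
  have comp_r: "computable_rat_seq2 r"
    unfolding computable_rat_seq2_def r_def
    by (rule exI[of _ "\<lambda>n i. Suc i * sel n i"], rule exI[of _ "\<lambda>n i. 0"], rule exI[of _ "\<lambda>n i. K' n"])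
      (intro conjI computable2I recursive_intros recursive_on_computable1[OF comp_K']
        recursive_on_computable2[OF comp_sel] allI refl; simp)
  have comp_p: "computable1 p"
    unfolding p_def
    by (intro computable1I recursive_intros recursive_on_computable1[OF comp_K]
        recursive_on_computable2[OF comp_sel]) auto
  have A_eq: "A n = {0..1} \<inter> (\<Union>i\<in>{i. sel n i = 1}. {(real i - 1) / K n <..< (real i + 1) / K n})" for n
  proof -
    have ends: "real_of_rat (l n i) = (real i - 1) * sel n i / K n" "real_of_rat (r n i) = (real i + 1) * sel n i / K n" for i
      unfolding l_def r_def K_def
      by (simp_all add: of_rat_divide of_rat_diff of_rat_add of_rat_mult algebra_simps)
    have "{real_of_rat (l n i) <..< real_of_rat (r n i)} =
        (if sel n i = 1 then {(real i - 1) / K n <..< (real i + 1) / K n} else {})" for i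
      unfolding ends by (auto simp: sel_def)
    then show ?thesis unfolding A_def by (auto split: if_splits)
  qed
  have near: "y \<in> {(real i - 1) / K n <..< (real i + 1) / K n} \<longleftrightarrow> \<bar>y - real i / K n\<bar> < 1 / K n" for y :: real and i n
    by (auto simp: abs_less_iff diff_divide_distrib add_divide_distrib)
  have meas: "measure lborel (A n) = p n / K n" for n
  proof -
    have "p n = card {j. j < K n \<and> (sel n j = 1 \<or> sel n (Suc j) = 1)}"
    proof -
      have "p n = (\<Sum>j<K n. if sel n j = 1 \<or> sel n (Suc j) = 1 then 1 else 0)"
        unfolding p_def by (intro sum.cong refl) (auto simp: sel_def)
      then show ?thesis by (simp add: sum.If_cases Int_def del: One_nat_def)
    qed
    then show ?thesis unfolding A_eq by (subst measure_grid_cells[OF K0]) (simp only: mem_Collect_eq)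
  qed
  have A_le: "measure lborel (A n) \<le> d / ((n + d) * (n + d + 1))" for n
  proof -
    define M where "M = n + d"
    have M: "1 \<le> real M" using d by (simp add: M_def)
    have "measure lborel (A n) \<le> (1 + 4 / k) / ((1 / E)\<^sup>2 * (real M)\<^sup>2)"
    proof (rule measure_large_cos_sum_le[of k v W M "1 / E" "A n" \<phi>])
      show "A n \<in> sets borel" unfolding A_def by (intro sets.Int borel_closed borel_open) auto
      show "A n \<subseteq> {0..1}" by (simp add: A_def)
      fix y assume "y \<in> A n"
      then obtain i where "sel n i = 1" "\<bar>y - real i / K n\<bar> < 1 / K n" unfolding A_eq UN_iff Int_iff near by auto
      then have "N n / E < \<bar>C n y\<bar>" by (intro sel1[of y i n]) auto
      then show "1 / real E * real M ^ 4 \<le> \<bar>\<Sum>j<M ^ 4. cos (W * v j * y + \<phi>)\<bar>"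
        unfolding C_def f_def N4 M_def by (simp add: mult.assoc)
    qed (use k sep W d E in \<open>auto simp: v_def M_def\<close>)
    also have "\<dots> = B / (real M)\<^sup>2" by (simp add: B_def)
    also have "\<dots> \<le> d / (real M * (real M + 1))"
    proof -
      have "B * (real M + 1) \<le> B * (2 * real M)" using B M by (intro mult_left_mono) auto
      also have "\<dots> \<le> d * real M" using d M by (simp add: mult_right_mono)
      finally have "B * (real M + 1) * real M \<le> d * real M * real M" using M by (intro mult_right_mono) auto
      then show ?thesis using M by (simp add: divide_simps power2_eq_square mult_ac)
    qed
    finally show ?thesis by (simp add: M_def algebra_simps)
  qed
  have "finite {n. x \<in> A n}"
    unfolding A_def
    by (rule schnorr_random_finite_cover[OF x comp_l comp_r comp_p comp_K K0
          meas[unfolded A_def] d(2) A_le[unfolded A_def]])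
  then have "\<forall>\<^sub>F n in sequentially. x \<notin> A n"
    unfolding cofinite_eq_sequentially[symmetric] eventually_cofinite by simp
  then have "\<forall>\<^sub>F n in sequentially. \<bar>C n x\<bar> \<le> 5 * (N n / E)"
  proof eventually_elim
    fix n assume n: "x \<notin> A n"
    have x01: "x \<in> {0..1}" using x by (simp add: schnorr_random_def)
    \<comment> \<open>Rounding down puts \<open>x\<close> at distance strictly less than
      \<open>1 / K n\<close> from a grid point, also for \<open>x = 1\<close>, where
      \<open>i = K n\<close>. So \<open>x\<close> lies in the open interval around it, and selection
      would put \<open>x\<close> into \<open>A n\<close>.\<close>
    define i where "i = nat \<lfloor>K n * x\<rfloor>"
    have "real i \<le> K n * x" "K n * x < real i + 1" using x01 by (auto simp: i_def)
    then have "\<bar>K n * x - real i\<bar> < 1" by linarith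
    moreover have "x - real i / K n = (K n * x - real i) / K n" using K0[of n] by (simp add: field_simps)
    ultimately have close: "\<bar>x - real i / K n\<bar> < 1 / K n"
      using K0[of n] by (simp add: abs_divide divide_strict_right_mono)
    have "sel n i \<noteq> 1"
    proof
      assume "sel n i = 1"
      moreover have "x \<in> {(real i - 1) / K n <..< (real i + 1) / K n}" unfolding near by (rule close)
      ultimately show False using n x01 unfolding A_eq by blast
    qed
    then show "\<bar>C n x\<bar> \<le> 5 * (N n / E)" using close by (intro sel0[of x i n]) auto
  qed
  then have "\<forall>\<^sub>F n in sequentially.
    \<bar>\<Sum>j<(n + d) ^ 4. cos (2 * pi * of_int h * (real_of_rat (u j) * x) + \<phi>)\<bar> \<le> 5 / E * real (n + d) ^ 4"
    by (simp add: C_def f_def N4 W_def v_def mult.assoc)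
  then show ?thesis
    by (rule eventually_sequentially_seg[of "\<lambda>n. \<bar>\<Sum>j<n ^ 4. cos (2 * pi * of_int h * (real_of_rat (u j) * x) + \<phi>)\<bar> \<le> 5 / E * real n ^ 4" d, THEN iffD1])
qed

lemma cos_mean_tendsto_0:
  fixes u :: "nat \<Rightarrow> rat"
  assumes x: "schnorr_random x" and u: "computable_rat_seq u"
    and k: "0 < k" and sep: "\<And>i j. i \<noteq> j \<Longrightarrow> k < \<bar>real_of_rat (u i) - real_of_rat (u j)\<bar>"
    and h: "h \<noteq> 0"
  shows "(\<lambda>N. (\<Sum>j<N. cos (2 * pi * of_int h * (real_of_rat (u j) * x) + \<phi>)) / real N) \<longlonglongrightarrow> 0"
proof (rule mean_tendsto_0_from_fourth_powers[OF abs_cos_le_one tendstoI])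
  fix e :: real assume "0 < e"
  then obtain E :: nat where E: "0 < E" "5 / e < E"
    using reals_Archimedean2[of "5 / e"] by (metis divide_pos_pos less_trans of_nat_0_less_iff zero_less_numeral)
  then have "5 / E < e" using \<open>0 < e\<close> by (simp add: field_simps)
  have bound: "\<forall>\<^sub>F n in sequentially.
      \<bar>\<Sum>j<n ^ 4. cos (2 * pi * of_int h * (real_of_rat (u j) * x) + \<phi>)\<bar> \<le> 5 / E * real n ^ 4"
    by (rule eventually_cos_sum_le[OF x u k sep h E(1)])
  show "\<forall>\<^sub>F n in sequentially.
      dist ((\<Sum>j<n ^ 4. cos (2 * pi * of_int h * (real_of_rat (u j) * x) + \<phi>)) / real n ^ 4) 0 < e"
    using bound eventually_gt_at_top[of 0]
  proof eventually_elim
    fix n :: nat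
    assume n: "\<bar>\<Sum>j<n ^ 4. cos (2 * pi * of_int h * (real_of_rat (u j) * x) + \<phi>)\<bar> \<le> 5 / E * real n ^ 4" "0 < n"
    then have "\<bar>\<Sum>j<n ^ 4. cos (2 * pi * of_int h * (real_of_rat (u j) * x) + \<phi>)\<bar> / real n ^ 4 \<le> 5 / E"
      by (simp add: pos_divide_le_eq)
    then show "dist ((\<Sum>j<n ^ 4. cos (2 * pi * of_int h * (real_of_rat (u j) * x) + \<phi>)) / real n ^ 4) 0 < e"
      using \<open>5 / E < e\<close> by (simp add: dist_real_def)
  qed
qed

theorem mainTheorem6:
  fixes x :: real and u :: "nat \<Rightarrow> rat"
  assumes "x \<in> {0..1}" and "schnorr_random x"
    and "computable_rat_seq u"
    and "\<exists>k>0. \<forall>i j. i \<noteq> j \<longrightarrow> \<bar>u i - u j\<bar> > k"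
  shows "ud_mod1 (\<lambda>n. real_of_rat (u n) * x)"
proof (rule Weyl_criterion)
  obtain k where k: "k > 0" "\<And>i j. i \<noteq> j \<Longrightarrow> k < \<bar>u i - u j\<bar>" using assms(4) by blast
  have "real_of_rat k < \<bar>real_of_rat (u i) - real_of_rat (u j)\<bar>" if "i \<noteq> j" for i j
    using k(2)[OF that] by (metis abs_of_rat of_rat_diff of_rat_less)
  then show "(\<lambda>N. (\<Sum>j<N. cos (2 * pi * of_int h * (real_of_rat (u j) * x) + \<phi>)) / real N) \<longlonglongrightarrow> 0"
    if "h \<noteq> 0" for h \<phi>
    using k(1) that by (intro cos_mean_tendsto_0[OF assms(2,3), of "real_of_rat k"]) auto
qed

end
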